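(* The greedy random walk on $\mathbb{Z}^2$ with rule $\mathcal{R}_{\mathrm{RAND}}$, started at the origin, returns to the origin infinitely often almost surely if and only if, in the planar mirror model on $\mathbb{Z}^2$, almost surely every orbit is periodic.
   Context: A greedy random walk (GRW) on a connected locally finite graph $G=(V,E)$ started at $v_0$: $X_0=v_0$; with $H_t=\{\{X_{s-1},X_s\}:0<s\le t\}$ and $J_t(v)=\{e\in E: v\in e, e\notin H_t\}$, if $J_t(X_t)\ne\emptyset$ then $X_{t+1}$ is chosen by the rule $\mathcal{R}_{\mathrm{RAND}}$: uniformly at random among the endpoints (other than $X_t$) of the edges in $J_t(X_t)$; if $J_t(X_t)=\emptyset$ then $X_{t+1}$ is a uniformly random neighbor of $X_t$. Planar mirror model: independently at each vertex of $\mathbb{Z}^2$, place a two-sided mirror along one of the two diagonal directions (each with probability $1/3$), or no mirror (probability $1/3$). A particle moves along the edges of $\mathbb{Z}^2$ one unit per step; at a vertex with no mirror it continues straight, and at a vertex with a mirror it is deflected by the law of reflection. An orbit (trajectory of a particle started at some vertex in some direction) is periodic if the particle eventually returns to its starting vertex moving in its starting direction. *)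

theory Defs
  imports "HOL-Probability.Probability"
begin

type_synonym vtx = "int \<times> int"

definition vadd :: "vtx \<Rightarrow> vtx \<Rightarrow> vtx" where
  "vadd p d = (fst p + fst d, snd p + snd d)"

definition dirs :: "vtx list" where
  "dirs = [(1,0), (0,1), (-1,0), (0,-1)]"

definition used_edges :: "vtx list \<Rightarrow> vtx set set" where
  "used_edges hs = set (map (\<lambda>(a,b). {a,b}) (zip hs (tl hs)))"

definition grw_candidates :: "vtx list \<Rightarrow> vtx list" where
  "grw_candidates hs =
     (let x = last hs;
          nbrs = map (vadd x) dirs;
          fresh = filter (\<lambda>w. {x, w} \<notin> used_edges hs) nbrs
      in if fresh = [] then nbrs else fresh)"

text \<open>The randomness is an i.i.d. sequence of uniform elements of {0..<12};
  since every candidate list has length 1,2,3 or 4 (all dividing 12), choosing index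
  (u mod length) selects a uniformly random candidate, independently of the past.\<close>
fun grw_hist :: "(nat \<Rightarrow> nat) \<Rightarrow> nat \<Rightarrow> vtx list" where
  "grw_hist \<omega> 0 = [(0,0)]"
| "grw_hist \<omega> (Suc t) =
     (let hs = grw_hist \<omega> t; cs = grw_candidates hs
      in hs @ [cs ! (\<omega> t mod length cs)])"

definition grw_pos :: "(nat \<Rightarrow> nat) \<Rightarrow> nat \<Rightarrow> vtx" where
  "grw_pos \<omega> t = last (grw_hist \<omega> t)"

definition grw_space :: "(nat \<Rightarrow> nat) measure" where
  "grw_space = PiM UNIV (\<lambda>_. measure_pmf (pmf_of_set {..<12::nat}))"

datatype mirror = Slash | Backslash | NoMirror

fun reflect :: "mirror \<Rightarrow> vtx \<Rightarrow> vtx" where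
  "reflect Slash (a,b) = (b,a)"
| "reflect Backslash (a,b) = (-b,-a)"
| "reflect NoMirror d = d"

definition mirror_space :: "(vtx \<Rightarrow> mirror) measure" where
  "mirror_space = PiM UNIV (\<lambda>_. measure_pmf (pmf_of_set {Slash, Backslash, NoMirror}))"

text \<open>One step of the particle: state (p,d) = at vertex p, leaving in direction d.
  It moves to p+d and is deflected there by the mirror at p+d.\<close>
definition mirror_step :: "(vtx \<Rightarrow> mirror) \<Rightarrow> vtx \<times> vtx \<Rightarrow> vtx \<times> vtx" where
  "mirror_step c s = (let q = vadd (fst s) (snd s) in (q, reflect (c q) (snd s)))"

definition periodic_orbit :: "(vtx \<Rightarrow> mirror) \<Rightarrow> vtx \<Rightarrow> vtx \<Rightarrow> bool" where
  "periodic_orbit c v d \<longleftrightarrow> (\<exists>n>0. (mirror_step c ^^ n) (v, d) = (v, d))"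

end

(* Pairing the edges at a vertex by its mirror turns an orbit of the mirror model into a walk that never
   reuses an edge, unless the orbit is periodic; and, up to bounded factors, a path is followed by an
   orbit with the same probability as by the greedy steps of the walk: arriving at a new vertex there
   are three equally likely continuations, at the second arrival there is only one. Hence the walk
   can take greedy steps forever (and then it visits the origin finitely often) with positive
   probability if and only if some orbit is aperiodic with positive probability. If greedy excursions
   are almost surely finite then, the degrees being even, each of them returns to where it began, so
   deleting them leaves a simple random walk, which is recurrent on the square lattice. To see that
   walk, the randomness is read from two tapes, one for greedy and one for non-greedy steps; this does not
   change the law of the walk. *)
theory Submission
  imports Defs
begin

section \<open>Histories and greedy extensions\<close>

text \<open>The two directions are not symmetric. A walk that is greedy from time 0 can be compared
  with an orbit directly, but a greedy run starting at a time \<open>T\<close> finds the edges of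
  some history \<open>h\<close> already used. There are only countably many \<open>h\<close>, so
  each can be fixed: forgetting its edges only enlarges the set of continuations, and the vertices
  of \<open>h\<close>, where the factor 1/3 may fail, cost at most \<open>3 ^ card (set h)\<close>,
  a constant as the run grows. The second tape answers a similar difficulty. Non-greedy steps happen
  at random times, so with coins indexed by time the walk left after deleting excursions would have
  to be extracted at stopping times. With a tape of its own it is literally \<open>srw\<close> of
  that tape, whatever the excursions do. Changing tapes is legitimate because a finite history has
  the same probability under every addressing that never rereads a cell, and because absence of
  visits after a given time is a limit of events about finite histories.\<close>

definition fresh_nbrs :: "vtx list \<Rightarrow> vtx list" where
  "fresh_nbrs hs = filter (\<lambda>w. {last hs, w} \<notin> used_edges hs) (map (vadd (last hs)) dirs)"

lemma grw_candidates_eq: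
  "grw_candidates hs = (if fresh_nbrs hs = [] then map (vadd (last hs)) dirs else fresh_nbrs hs)"
  by (simp add: grw_candidates_def fresh_nbrs_def Let_def)

lemma zip_tl_snoc: "q \<noteq> [] \<Longrightarrow> zip (q @ [x]) (tl (q @ [x])) = zip q (tl q) @ [(last q, x)]"
proof (induction q)
  case (Cons a q)
  then show ?case by (cases q) auto
qed simp

lemma used_edges_snoc:
  assumes "q \<noteq> []"
  shows "used_edges (q @ [x]) = insert {last q, x} (used_edges q)"
  using zip_tl_snoc[OF assms, of x] by (simp add: used_edges_def)

lemma set_eq_insert_last: "xs \<noteq> [] \<Longrightarrow> set xs = insert (last xs) (set (butlast xs))"
  by (cases xs rule: rev_cases) auto

lemma used_edges_single [simp]: "used_edges [x] = {}"
  by (simp add: used_edges_def)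

lemma used_edges_subset: "e \<in> used_edges q \<Longrightarrow> e \<subseteq> set q"
proof -
  assume "e \<in> used_edges q"
  then obtain a b where ab: "(a, b) \<in> set (zip q (tl q))" "e = {a, b}"
    by (auto simp: used_edges_def)
  have "a \<in> set q" "b \<in> set (tl q)" using ab(1) by (blast dest: set_zip_leftD set_zip_rightD)+
  then show ?thesis using ab(2) by (cases q) auto
qed

lemma length_dirs [simp]: "length dirs = 4"
  by (simp add: dirs_def)

lemma distinct_nbrs: "distinct (map (vadd x) dirs)"
  by (simp add: dirs_def vadd_def)

lemma vadd_inject [simp]: "vadd x d = vadd x d' \<longleftrightarrow> d = d'"
  by (auto simp: vadd_def prod_eq_iff)

lemma vadd_neq [simp]: "d \<in> set dirs \<Longrightarrow> vadd x d \<noteq> x" "d \<in> set dirs \<Longrightarrow> x \<noteq> vadd x d"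
  by (auto simp: vadd_def dirs_def prod_eq_iff)

lemma distinct_candidates: "distinct (grw_candidates q)"
  using distinct_nbrs[of "last q"] by (simp add: grw_candidates_eq fresh_nbrs_def)

lemma length_candidates: "length (grw_candidates q) \<in> {1, 2, 3, 4}"
proof -
  have "length (fresh_nbrs q) \<le> 4"
    unfolding fresh_nbrs_def by (rule order.trans[OF length_filter_le]) (simp add: dirs_def)
  moreover have "length (map (vadd (last q)) dirs) = 4" by (simp add: dirs_def)
  ultimately show ?thesis
    by (cases "length (fresh_nbrs q)") (auto simp: grw_candidates_eq)
qed

lemma set_fresh: "set (fresh_nbrs q) = {vadd (last q) d |d. d \<in> set dirs \<and> {last q, vadd (last q) d} \<notin> used_edges q}"
  by (auto simp: fresh_nbrs_def)

fun greedy_exts :: "vtx list \<Rightarrow> nat \<Rightarrow> vtx list set" where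
  "greedy_exts h 0 = {[]}"
| "greedy_exts h (Suc n) = (\<Union>p\<in>greedy_exts h n. (\<lambda>x. p @ [x]) ` set (fresh_nbrs (h @ p)))"

lemma finite_greedy_exts [simp]: "finite (greedy_exts h n)"
  by (induction n) auto

lemma greedy_exts_length: "p \<in> greedy_exts h n \<Longrightarrow> length p = n"
  by (induction n arbitrary: p) auto

lemma greedy_exts_snoc:
  "p @ [x] \<in> greedy_exts h (Suc n) \<longleftrightarrow> p \<in> greedy_exts h n \<and> x \<in> set (fresh_nbrs (h @ p))"
  by auto

text \<open>The vertex \<open>last h\<close> stays in front of \<open>p\<close> because the step
  from the history into \<open>p\<close> uses an edge too.\<close>

lemma used_edges_append_mono: "used_edges (last h # p) \<subseteq> used_edges (h @ p)" if "h \<noteq> []"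
  using that
proof (induction p rule: rev_induct)
  case Nil
  then show ?case by simp
next
  case (snoc x p)
  have "used_edges (last h # p @ [x]) = used_edges ((last h # p) @ [x])" by simp
  also have "\<dots> = insert {last (last h # p), x} (used_edges (last h # p))"
    by (rule used_edges_snoc) simp
  finally have 1: "used_edges (last h # p @ [x]) = insert {last (last h # p), x} (used_edges (last h # p))" .
  have "used_edges (h @ p @ [x]) = insert {last (h @ p), x} (used_edges (h @ p))"
    using used_edges_snoc[of "h @ p" x] snoc.prems by simp
  moreover have "last (last h # p) = last (h @ p)" using snoc.prems by simp
  ultimately show ?case using 1 snoc by (simp add: insert_mono subset_insertI2)
qed

text \<open>Forgetting the history only frees edges, so a greedy run after \<open>h\<close> is also
  a greedy run from a blank start. This is how \<open>h\<close> disappears in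
  \<open>periodic_imp_not_greedy\<close>.\<close>

lemma greedy_exts_mono:
  assumes "h \<noteq> []"
  shows "greedy_exts h n \<subseteq> greedy_exts [last h] n"
proof (induction n)
  case (Suc n)
  show ?case
  proof
    fix q assume "q \<in> greedy_exts h (Suc n)"
    then obtain p x where q: "q = p @ [x]" "p \<in> greedy_exts h n" "x \<in> set (fresh_nbrs (h @ p))" by auto
    have "last (h @ p) = last ([last h] @ p)" using assms by simp
    then have "set (fresh_nbrs (h @ p)) \<subseteq> set (fresh_nbrs ([last h] @ p))"
      using used_edges_append_mono[OF assms, of p] unfolding set_fresh by auto
    then show "q \<in> greedy_exts [last h] (Suc n)" using q Suc by auto
  qed
qed simp

text \<open>The factor at \<open>i\<close> is the chance of stepping to \<open>q ! Suc i\<close>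
  given the first \<open>Suc i\<close> positions. No coins occur in it; for \<open>q\<close>
  starting at the origin \<open>prob_tape_hist\<close> identifies it with the probability of the
  history \<open>q\<close>.\<close>

definition weight :: "vtx list \<Rightarrow> real" where
  "weight q = (\<Prod>i<length q - 1. if q ! Suc i \<in> set (grw_candidates (take (Suc i) q))
      then 1 / real (length (grw_candidates (take (Suc i) q))) else 0)"

lemma weight_single [simp]: "weight [x] = 1"
  by (simp add: weight_def)

lemma weight_snoc:
  assumes "q \<noteq> []"
  shows "weight (q @ [x]) = weight q *
    (if x \<in> set (grw_candidates q) then 1 / real (length (grw_candidates q)) else 0)"
proof -
  have l: "length (q @ [x]) - 1 = Suc (length q - 1)" using assms by (cases q) auto
  have "\<And>i. i < length q - 1 \<Longrightarrow> Suc i < length q \<and> (q @ [x]) ! Suc i = q ! Suc i \<and> take (Suc i) (q @ [x]) = take (Suc i) q"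
    by (auto simp: nth_append)
  then have "weight (q @ [x]) = weight q * (if (q @ [x]) ! Suc (length q - 1) \<in> set (grw_candidates (take (Suc (length q - 1)) (q @ [x])))
      then 1 / real (length (grw_candidates (take (Suc (length q - 1)) (q @ [x])))) else 0)"
    unfolding weight_def l prod.lessThan_Suc by (intro arg_cong2[where f="(*)"] prod.cong) auto
  moreover have "Suc (length q - 1) = length q" using assms by (cases q) auto
  ultimately show ?thesis by simp
qed

lemma weight_nonneg: "weight q \<ge> 0"
  unfolding weight_def by (intro prod_nonneg) auto

lemma weight_le_1: "weight q \<le> 1"
proof -
  have "\<And>r. length (grw_candidates r) \<ge> 1" using length_candidates by (metis One_nat_def insertE le_numeral_extra(4) one_le_numeral singletonD)
  then show ?thesis unfolding weight_def by (intro prod_le_1) (auto simp: divide_simps Suc_le_eq)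
qed

lemma weight_append_le: assumes "h \<noteq> []" shows "weight (h @ p) \<le> weight h"
proof (induction p rule: rev_induct)
  case (snoc x p)
  have "weight (h @ p @ [x]) \<le> weight (h @ p)"
  proof -
    have "length (grw_candidates (h @ p)) \<ge> 1" using length_candidates[of "h @ p"] by auto
    then show ?thesis using weight_snoc[of "h @ p" x] weight_nonneg[of "h @ p"] assms
      by (auto simp: divide_simps mult_le_cancel_left1)
  qed
  with snoc show ?case by simp
qed simp

section \<open>Degrees in the graph of used edges\<close>

definition used_degree :: "vtx list \<Rightarrow> vtx \<Rightarrow> nat" where
  "used_degree q u = card {d \<in> set dirs. {u, vadd u d} \<in> used_edges q}"

lemma length_fresh: "length (fresh_nbrs q) + used_degree q (last q) = 4"
proof -
  have "distinct (fresh_nbrs q)"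
    unfolding fresh_nbrs_def by (intro distinct_filter distinct_nbrs)
  then have "length (fresh_nbrs q) = card (set (fresh_nbrs q))" by (simp add: distinct_card)
  also have "set (fresh_nbrs q) = vadd (last q) ` {d \<in> set dirs. {last q, vadd (last q) d} \<notin> used_edges q}"
    unfolding set_fresh by blast
  also have "card \<dots> = card {d \<in> set dirs. {last q, vadd (last q) d} \<notin> used_edges q}"
    by (simp add: card_image inj_on_def)
  also have "\<dots> + used_degree q (last q) = card (set dirs)"
    unfolding used_degree_def by (subst card_Un_disjoint[symmetric]) (auto intro!: arg_cong[where f=card])
  also have "card (set dirs) = 4" by (simp add: dirs_def)
  finally show ?thesis .
qed

lemma used_degree_not_visited: "u \<notin> set q \<Longrightarrow> used_degree q u = 0"
  using used_edges_subset by (fastforce simp: used_degree_def)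

lemma vadd_neg: "d \<in> set dirs \<Longrightarrow> w = vadd u d \<Longrightarrow> \<exists>d0\<in>set dirs. u = vadd w d0"
  by (auto simp: dirs_def vadd_def)

text \<open>The new edge has exactly one direction at each of its ends: \<open>d\<close> at the old
  end and the reverse direction \<open>d0\<close> at the new one.\<close>

lemma used_degree_snoc:
  assumes "q \<noteq> []" "x \<in> set (fresh_nbrs q)"
  shows "used_degree (q @ [x]) u = used_degree q u + (if u = last q \<or> u = x then 1 else 0)"
proof -
  obtain d where d: "d \<in> set dirs" "x = vadd (last q) d" "{last q, x} \<notin> used_edges q"
    using assms(2) by (auto simp: set_fresh)
  obtain d0 where d0: "d0 \<in> set dirs" "last q = vadd x d0" using vadd_neg[OF d(1,2)] by blast
  define D where "D = {d \<in> set dirs. {u, vadd u d} \<in> used_edges q}"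
  have D': "used_degree (q @ [x]) u = card {e \<in> set dirs. e \<in> D \<or> {u, vadd u e} = {last q, x}}"
    using used_edges_snoc[OF assms(1), of x] unfolding used_degree_def D_def
    by (intro arg_cong[where f=card]) auto
  have ne: "x \<noteq> last q" using d by auto
  consider "u = last q" | "u = x" | "u \<noteq> last q" "u \<noteq> x" by blast
  then show ?thesis
  proof cases
    case 1
    have "{e \<in> set dirs. e \<in> D \<or> {u, vadd u e} = {last q, x}} = insert d D"
      using 1 d ne by (auto simp: D_def doubleton_eq_iff)
    moreover have "d \<notin> D" using d 1 by (auto simp: D_def)
    moreover have "finite D" by (simp add: D_def)
    ultimately show ?thesis using 1 D' by (simp add: D_def used_degree_def)
  next
    case 2
    have "{e \<in> set dirs. e \<in> D \<or> {u, vadd u e} = {last q, x}} = insert d0 D"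
      using 2 d0 ne by (auto simp: D_def doubleton_eq_iff)
    moreover have "d0 \<notin> D" using d d0 2 by (auto simp: D_def insert_commute)
    moreover have "finite D" by (simp add: D_def)
    ultimately show ?thesis using 2 D' by (simp add: D_def used_degree_def)
  next
    case 3
    then have "{e \<in> set dirs. e \<in> D \<or> {u, vadd u e} = {last q, x}} = D"
      by (auto simp: D_def doubleton_eq_iff)
    then show ?thesis using 3 D' by (simp add: D_def used_degree_def)
  qed
qed

text \<open>When a vertex outside \<open>h\<close> is left for the first time, only the edge of
  arrival is used there, so that step has probability 1/3; all other factors are at most 1. The last
  vertex has not been left, hence \<open>butlast\<close>; at vertices of \<open>h\<close> the used
  degree is unknown, hence the difference.\<close>

lemma weight_greedy_upper:
  assumes "h \<noteq> []" "p \<in> greedy_exts h n"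
  shows "weight (h @ p) \<le> (1/3) ^ card (set (butlast p) - set h)"
  using assms(2)
proof (induction n arbitrary: p)
  case 0
  then show ?case using weight_le_1 by simp
next
  case (Suc n)
  then obtain p' x where p: "p = p' @ [x]" "p' \<in> greedy_exts h n" "x \<in> set (fresh_nbrs (h @ p'))" by auto
  have IH: "weight (h @ p') \<le> (1/3) ^ card (set (butlast p') - set h)" using Suc.IH p by blast
  show ?case
  proof (cases "p' = [] \<or> last p' \<in> set (butlast p') \<union> set h")
    case True
    have "set p' - set h = set (butlast p') - set h"
    proof (cases "p' = []")
      case False
      then show ?thesis using True False set_eq_insert_last[of p'] by auto
    qed simp
    moreover have "weight ((h @ p') @ [x]) \<le> weight (h @ p')" by (rule weight_append_le) (use assms in simp)
    ultimately show ?thesis using IH p by simp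
  next
    case False
    define r u where "r = butlast p'" and "u = last p'"
    have p': "p' = r @ [u]" using False by (simp add: r_def u_def)
    have nu: "u \<notin> set (h @ r)" using False by (auto simp: r_def u_def)
    have "n = Suc (length r)" using greedy_exts_length[OF p(2)] p' by simp
    then have "u \<in> set (fresh_nbrs (h @ r))" using p(2) p' by (auto simp del: greedy_exts.simps simp: greedy_exts_snoc)
    then have "used_degree ((h @ r) @ [u]) u = 1"
      using used_degree_snoc[of "h @ r" u u] used_degree_not_visited[OF nu] assms by simp
    then have "length (fresh_nbrs (h @ p')) = 3" using length_fresh[of "h @ p'"] by (simp add: p')
    then have l: "length (grw_candidates (h @ p')) = 3" by (auto simp: grw_candidates_eq)
    have "weight (h @ p) \<le> weight (h @ p') * (1/3)"
      using weight_snoc[of "h @ p'" x] assms p l weight_nonneg[of "h @ p'"] by auto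
    also have "\<dots> \<le> (1/3) ^ card (set r - set h) * (1/3)" using IH by (simp add: r_def)
    also have "\<dots> = (1/3) ^ card (set p' - set h)"
    proof -
      have "set p' - set h = insert u (set r - set h)" using nu p' by auto
      then have "card (set p' - set h) = Suc (card (set r - set h))" using nu by simp
      then show ?thesis by simp
    qed
    finally show ?thesis by (simp add: p)
  qed
qed

section \<open>Mirror orbits without repeated edges\<close>

text \<open>Entering such a vertex and leaving it use one new edge each.\<close>

lemma used_degree_interior:
  assumes "h \<noteq> []" "p \<in> greedy_exts h n" "u \<in> set (butlast p)"
  shows "used_degree (h @ p) u \<ge> 2"
  using assms(2,3)
proof (induction n arbitrary: p)
  case 0
  then show ?case by simp
next
  case (Suc n)
  then obtain p' x where p: "p = p' @ [x]" "p' \<in> greedy_exts h n" "x \<in> set (fresh_nbrs (h @ p'))" by auto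
  have st: "used_degree (h @ p) u = used_degree (h @ p') u + (if u = last (h @ p') \<or> u = x then 1 else 0)"
    using used_degree_snoc[of "h @ p'" x u] p assms(1) by simp
  have u: "u \<in> set p'" using Suc.prems p by simp
  show ?case
  proof (cases "u \<in> set (butlast p')")
    case True
    then show ?thesis using Suc.IH[OF p(2)] st by simp
  next
    case False
    then obtain r where r: "p' = r @ [u]"
      using u by (cases p' rule: rev_cases) auto
    have "n = Suc (length r)" using greedy_exts_length[OF p(2)] r by simp
    then have "u \<in> set (fresh_nbrs (h @ r))" using p(2) r
      by (auto simp del: greedy_exts.simps simp: greedy_exts_snoc)
    then have "used_degree (h @ p') u \<ge> 1"
      using used_degree_snoc[of "h @ r" u u] r assms(1) by simp
    then show ?thesis using st r by simp
  qed
qed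

text \<open>From a blank start the first step has probability at least 1/4, which is the 4 on the
  right. After a first arrival at most three edges are free, so the factor is at least 1/3. After a
  later arrival at least three of the four edges are used, so the only possible step has probability
  1.\<close>

lemma weight_greedy_lower:
  assumes "p \<in> greedy_exts [v] n"
  shows "(1/3) ^ card (set (butlast p)) \<le> 4 * weight ([v] @ p)"
  using assms
proof (induction n arbitrary: p)
  case 0
  then show ?case by simp
next
  case (Suc n)
  then obtain p' x where p: "p = p' @ [x]" "p' \<in> greedy_exts [v] n" "x \<in> set (fresh_nbrs ([v] @ p'))" by auto
  have IH: "(1/3) ^ card (set (butlast p')) \<le> 4 * weight ([v] @ p')" using Suc.IH p by blast
  have w: "weight ([v] @ p) = weight ([v] @ p') / length (fresh_nbrs ([v] @ p'))"
    using weight_snoc[of "[v] @ p'" x] p by (auto simp: grw_candidates_eq)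
  have pos: "length (fresh_nbrs ([v] @ p')) \<ge> 1" using p(3) by (cases "fresh_nbrs ([v] @ p')") auto
  show ?case
  proof (cases "p' = []")
    case True
    have "real (length (fresh_nbrs ([v] @ p'))) \<le> 4" using length_fresh[of "[v] @ p'"] by linarith
    moreover have "real (length (fresh_nbrs ([v] @ p'))) > 0" using pos by linarith
    ultimately have "1 / real (length (fresh_nbrs ([v] @ p'))) \<ge> 1 / 4"
      by (intro divide_left_mono) auto
    then show ?thesis using w True p(1) by simp
  next
    case False
    define r u where "r = butlast p'" and "u = last p'"
    have p': "p' = r @ [u]" using False by (simp add: r_def u_def)
    have n: "n = Suc (length r)" using greedy_exts_length[OF p(2)] p' by simp
    then have u: "r \<in> greedy_exts [v] (length r)" "u \<in> set (fresh_nbrs ([v] @ r))" using p(2) p'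
      by (auto simp del: greedy_exts.simps simp: greedy_exts_snoc)
    have ud: "used_degree ([v] @ p') u = used_degree ([v] @ r) u + 1"
      using used_degree_snoc[of "[v] @ r" u u] u(2) p' by simp
    have lf: "length (fresh_nbrs ([v] @ p')) + used_degree ([v] @ p') u = 4"
      using length_fresh[of "[v] @ p'"] p' by simp
    show ?thesis
    proof (cases "u \<in> set r")
      case True
      have "u \<noteq> last ([v] @ r)" using u(2) by (auto simp: set_fresh)
      \<comment> \<open>The vertex just left differs from \<open>u\<close>, so the earlier visit to
        \<open>u\<close> in \<open>r\<close> has been completed.\<close>
      then have "u \<in> set (butlast r)" using True by (cases r rule: rev_cases) auto
      then have "used_degree ([v] @ r) u \<ge> 2" by (intro used_degree_interior[OF _ u(1)]) simp_all
      then have "length (fresh_nbrs ([v] @ p')) = 1" using ud lf pos by simp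
      then have "weight ([v] @ p) = weight ([v] @ p')" using w by simp
      moreover have "set (butlast p) = set (butlast p')" using True unfolding p(1) butlast_snoc p' by auto
      ultimately show ?thesis using IH by simp
    next
      case False
      have "card (set (butlast p)) = Suc (card (set (butlast p')))" using False unfolding p(1) butlast_snoc p' by simp
      moreover have "weight ([v] @ p) \<ge> weight ([v] @ p') / 3"
        unfolding w using ud lf pos weight_nonneg[of "[v] @ p'"] by (intro divide_left_mono) auto
      ultimately show ?thesis using IH by simp
    qed
  qed
qed

section \<open>Mirrors as pairings of the four directions\<close>

definition vneg :: "vtx \<Rightarrow> vtx" where
  "vneg d = (- fst d, - snd d)"

lemma vneg_simps [simp]: "vneg (vneg d) = d" "vadd (vadd u d) (vneg d) = u" "vadd (vadd u (vneg d)) d = u"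
  by (auto simp: vneg_def vadd_def)

lemma vneg_dirs [simp]: "d \<in> set dirs \<Longrightarrow> vneg d \<in> set dirs"
  by (auto simp: vneg_def dirs_def)

lemma vneg_neq [simp]: "d \<in> set dirs \<Longrightarrow> vneg d \<noteq> d"
  by (auto simp: vneg_def dirs_def)

lemma reflect_dirs [simp]: "d \<in> set dirs \<Longrightarrow> reflect m d \<in> set dirs"
  by (cases m; auto simp: dirs_def)

lemma reflect_reflect [simp]: "reflect m (reflect m d) = d"
  by (cases m; cases d; auto)

lemma reflect_vneg: "reflect m (vneg d) = vneg (reflect m d)"
  by (cases m; cases d; auto simp: vneg_def)

lemma reflect_neq_vneg: "d \<in> set dirs \<Longrightarrow> reflect m d \<noteq> vneg d"
  by (cases m; auto simp: vneg_def dirs_def)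

text \<open>The three mirror states correspond to the three ways to continue without turning back.
  This matches the factor 1/3 of the walk at a new vertex.\<close>

lemma ex1_mirror:
  "d \<in> set dirs \<Longrightarrow> d' \<in> set dirs \<Longrightarrow> d' \<noteq> vneg d \<Longrightarrow> \<exists>m. \<forall>m'. reflect m' d = d' \<longleftrightarrow> m' = m"
proof -
  assume a: "d \<in> set dirs" "d' \<in> set dirs" "d' \<noteq> vneg d"
  have "\<exists>m. reflect m d = d'"
    using a unfolding dirs_def
    by (intro exI[of _ "if d' = d then NoMirror else if d' = (snd d, fst d) then Slash else Backslash"])
      (auto simp: vneg_def)
  moreover have "reflect m d = reflect m' d \<Longrightarrow> m = m'" for m m'
    using a(1) unfolding dirs_def by (cases m; cases m') auto
  ultimately show ?thesis by metis
qed

text \<open>A mirror pairs up the four edges at its vertex, so one pair determines the other.\<close>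
lemma mirror_pairing:
  assumes "d1 \<in> set dirs" "d \<in> set dirs" "d' \<in> set dirs"
    and "distinct [d1, reflect m (vneg d1), vneg d, d']"
  shows "reflect m d = d'"
proof -
  have "\<forall>d1\<in>set dirs. \<forall>d\<in>set dirs. \<forall>d'\<in>set dirs. distinct [d1, reflect m (vneg d1), vneg d, d'] \<longrightarrow> reflect m d = d'"
    by (cases m) (simp_all add: dirs_def vneg_def)
  then show ?thesis using assms by blast
qed

text \<open>The start \<open>v\<close> is left out, as in \<open>greedy_exts\<close>, so that the
  list can be appended to a history ending in \<open>v\<close>.\<close>

definition orbit_path :: "(vtx \<Rightarrow> mirror) \<Rightarrow> vtx \<Rightarrow> vtx \<Rightarrow> nat \<Rightarrow> vtx list" where
  "orbit_path c v d n = map (\<lambda>i. fst ((mirror_step c ^^ Suc i) (v, d))) [0..<n]"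

lemma orbit_path_0 [simp]: "orbit_path c v d 0 = []"
  by (simp add: orbit_path_def)

lemma orbit_path_Suc: "orbit_path c v d (Suc n) = orbit_path c v d n @ [fst ((mirror_step c ^^ Suc n) (v, d))]"
  by (simp add: orbit_path_def)

lemma length_orbit_path [simp]: "length (orbit_path c v d n) = n"
  by (simp add: orbit_path_def)

lemma mirror_step_eq: "mirror_step c s = (vadd (fst s) (snd s), reflect (c (vadd (fst s) (snd s))) (snd s))"
  by (simp add: mirror_step_def Let_def)

lemma last_orbit_path: "last (v # orbit_path c v d n) = fst ((mirror_step c ^^ n) (v, d))"
  by (cases n) (simp_all add: orbit_path_Suc)

lemma orbit_dirs [simp]: "d \<in> set dirs \<Longrightarrow> snd ((mirror_step c ^^ n) (v, d)) \<in> set dirs"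
  by (induction n) (simp_all add: mirror_step_eq)

text \<open>At the first arrival at a vertex exactly one mirror gives the prescribed continuation.
  At the second, the two edges already used are paired by that mirror, which forces the other two to
  be paired, so nothing new is required. The second conjunct is the induction invariant that
  remembers the pair: the mirror at \<open>w\<close> joins the directions \<open>d1\<close> and
  \<open>reflect (m w) (vneg d1)\<close>, and both edges are used. At the end of \<open>p\<close>
  the pair must be found among the edges used before the current arrival, which is why
  \<open>q\<close> drops the last step there.\<close>

lemma orbit_path_follows:
  assumes "p \<in> greedy_exts [v] (Suc n)" "d \<in> set dirs" "hd p = vadd v d"
  shows "\<exists>m. {c. orbit_path c v d (Suc n) = p} = {c. \<forall>u\<in>set (butlast p). c u = m u} \<and>
    (\<forall>w\<in>set (butlast p). \<exists>d1\<in>set dirs. let q = (if w = last p then butlast p else p) in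
      {w, vadd w d1} \<in> used_edges ([v] @ q) \<and>
      {w, vadd w (reflect (m w) (vneg d1))} \<in> used_edges ([v] @ q))"
  using assms(1,3)
proof (induction n arbitrary: p)
  case 0
  then show ?case by (auto simp: orbit_path_Suc mirror_step_eq)
next
  case (Suc n)
  obtain p' x where p: "p = p' @ [x]" "p' \<in> greedy_exts [v] (Suc n)" "x \<in> set (fresh_nbrs ([v] @ p'))"
    using Suc.prems(1) by (subst (asm) greedy_exts.simps) blast
  define r u where "r = butlast p'" and "u = last p'"
  have lp': "length p' = Suc n" using greedy_exts_length p(2) by blast
  then have p': "p' = r @ [u]" by (cases p' rule: rev_cases) (auto simp: r_def u_def)
  have n: "n = length r" using lp' p' by simp
  then have ru: "r \<in> greedy_exts [v] n" "u \<in> set (fresh_nbrs ([v] @ r))" using p(2) p'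
    by (auto simp del: greedy_exts.simps simp: greedy_exts_snoc)
  have hd': "hd p' = vadd v d" using Suc.prems(2) p(1) p' by (cases r) auto
  obtain m where m: "{c. orbit_path c v d (Suc n) = p'} = {c. \<forall>u\<in>set (butlast p'). c u = m u}"
    and inv: "\<And>w. w \<in> set (butlast p') \<Longrightarrow> \<exists>d1\<in>set dirs. let q = (if w = last p' then butlast p' else p') in
      {w, vadd w d1} \<in> used_edges ([v] @ q) \<and>
      {w, vadd w (reflect (m w) (vneg d1))} \<in> used_edges ([v] @ q)"
    using Suc.IH[OF p(2) hd'] by blast
  let ?y = "last ([v] @ r)"
  obtain e where e: "e \<in> set dirs" "u = vadd ?y e" "{?y, u} \<notin> used_edges ([v] @ r)"
    using ru(2) by (auto simp: set_fresh)
  have y: "?y = vadd u (vneg e)" using e by simp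
  obtain d' where d': "d' \<in> set dirs" "x = vadd u d'" "{u, x} \<notin> used_edges ([v] @ p')"
    using p(3) p' by (auto simp: set_fresh)
  have ue: "used_edges ([v] @ p') = insert {?y, u} (used_edges ([v] @ r))"
    using used_edges_snoc[of "[v] @ r" u] p' by simp
  have ue2: "used_edges ([v] @ p) = insert {u, x} (used_edges ([v] @ p'))"
    using used_edges_snoc[of "[v] @ p'" x] p p' by simp
  have nback: "d' \<noteq> vneg e"
  proof
    assume "d' = vneg e"
    then have "x = ?y" using y d' by simp
    then show False using d'(3) ue by (auto simp: insert_commute)
  qed
  obtain m0 where m0: "\<And>m'. reflect m' e = d' \<longleftrightarrow> m' = m0" using ex1_mirror[OF e(1) d'(1) nback] by blast
  have step: "orbit_path c v d (Suc (Suc n)) = p \<longleftrightarrow> orbit_path c v d (Suc n) = p' \<and> c u = m0" for c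
  proof -
    have "orbit_path c v d (Suc (Suc n)) = p \<longleftrightarrow> orbit_path c v d (Suc n) = p' \<and> fst ((mirror_step c ^^ Suc (Suc n)) (v, d)) = x"
      using p(1) by (simp add: orbit_path_Suc[of _ _ _ "Suc n"] del: funpow.simps)
    moreover have "fst ((mirror_step c ^^ Suc (Suc n)) (v, d)) = x \<longleftrightarrow> c u = m0"
      if A: "orbit_path c v d (Suc n) = p'"
    proof -
      define s where "s = (mirror_step c ^^ n) (v, d)"
      have A': "orbit_path c v d n = r" "fst (mirror_step c s) = u"
        using A p' by (simp_all add: orbit_path_Suc s_def)
      have "fst s = ?y" using last_orbit_path[of v c d n] A'(1) by (simp add: s_def)
      with A'(2) e(2) have "snd s = e" by (simp add: mirror_step_eq)
      then have "mirror_step c s = (u, reflect (c u) e)"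
        using A'(2) by (simp add: mirror_step_eq)
      moreover have "(mirror_step c ^^ Suc (Suc n)) (v, d) = mirror_step c (mirror_step c s)" by (simp add: s_def)
      ultimately have "fst ((mirror_step c ^^ Suc (Suc n)) (v, d)) = vadd u (reflect (c u) e)"
        by (simp add: mirror_step_eq[of c "(u, _)"] del: funpow.simps)
      then show ?thesis using d'(2) m0 by simp
    qed
    ultimately show ?thesis by blast
  qed
  have sb: "set (butlast p) = insert u (set r)" "set (butlast p') = set r" unfolding p(1) butlast_snoc p' by simp_all
  have lst: "last p = x" "last p' = u" "butlast p' = r" "butlast p = p'" unfolding p(1) butlast_snoc by (simp_all add: p')
  have ux: "u \<noteq> x" using d' by simp
  have newpair: "{u, vadd u (vneg e)} \<in> used_edges ([v] @ p) \<and> {u, vadd u (reflect m0 (vneg (vneg e)))} \<in> used_edges ([v] @ p)"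
    using ue ue2 y d' m0[of m0] by (auto simp: insert_commute)
  have old: "\<exists>d1\<in>set dirs. let q = (if w = last p then butlast p else p) in
      {w, vadd w d1} \<in> used_edges ([v] @ q) \<and>
      {w, vadd w (reflect (m w) (vneg d1))} \<in> used_edges ([v] @ q)" if "w \<in> set r" "w \<noteq> u" for w
    using inv[of w] that sb lst ue2 by (auto simp: Let_def)
  show ?case
  proof (cases "u \<in> set r")
    case False
    have "{c. orbit_path c v d (Suc (Suc n)) = p} = {c. orbit_path c v d (Suc n) = p'} \<inter> {c. c u = m0}"
      using step by blast
    also have "\<dots> = {c. \<forall>w\<in>set (butlast p). c w = (m(u := m0)) w}"
      unfolding m using sb False by auto
    finally have 1: "{c. orbit_path c v d (Suc (Suc n)) = p} = \<dots>" .
    show ?thesis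
    proof (intro exI[of _ "m(u := m0)"] conjI 1 ballI)
      fix w assume w: "w \<in> set (butlast p)"
      show "\<exists>d1\<in>set dirs. let q = (if w = last p then butlast p else p) in
        {w, vadd w d1} \<in> used_edges ([v] @ q) \<and>
        {w, vadd w (reflect ((m(u := m0)) w) (vneg d1))} \<in> used_edges ([v] @ q)"
      proof (cases "w = u")
        case True
        then show ?thesis using newpair ux e(1) lst by (intro bexI[of _ "vneg e"]) (auto simp: Let_def)
      next
        case False
        then show ?thesis using old[of w] w sb by auto
      qed
    qed
  next
    case True
    obtain d1 where d1: "d1 \<in> set dirs" "{u, vadd u d1} \<in> used_edges ([v] @ r)"
      "{u, vadd u (reflect (m u) (vneg d1))} \<in> used_edges ([v] @ r)"
      using inv[of u] True sb lst by (auto simp: Let_def)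
    \<comment> \<open>Four different edges at \<open>u\<close>: the old pair, the edge of arrival
      and the edge of departure.\<close>
    have "distinct [d1, reflect (m u) (vneg d1), vneg e, d']"
      using d1 e(3) d'(2,3) ue nback y reflect_neq_vneg[of "vneg d1" "m u"]
      by (auto simp: insert_commute)
    then have "reflect (m u) e = d'" using mirror_pairing d1(1) e(1) d'(1) by blast
    then have mu: "m u = m0" using m0 by blast
    have "{c. orbit_path c v d (Suc (Suc n)) = p} = {c. orbit_path c v d (Suc n) = p'} \<inter> {c. c u = m0}"
      using step by blast
    also have "\<dots> = {c. \<forall>w\<in>set (butlast p). c w = m w}"
      unfolding m using sb True mu by auto
    finally have 1: "{c. orbit_path c v d (Suc (Suc n)) = p} = \<dots>" .
    show ?thesis
    proof (intro exI[of _ m] conjI 1 ballI)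
      fix w assume w: "w \<in> set (butlast p)"
      show "\<exists>d1\<in>set dirs. let q = (if w = last p then butlast p else p) in
        {w, vadd w d1} \<in> used_edges ([v] @ q) \<and>
        {w, vadd w (reflect (m w) (vneg d1))} \<in> used_edges ([v] @ q)"
      proof (cases "w = u")
        case True
        then show ?thesis using newpair mu ux e(1) lst by (intro bexI[of _ "vneg e"]) (auto simp: Let_def)
      next
        case False
        then show ?thesis using old[of w] w sb by auto
      qed
    qed
  qed
qed

section \<open>The walk driven by tapes\<close>

lemma inj_mirror_step: "inj (mirror_step c)"
proof (rule injI)
  fix s s' assume e: "mirror_step c s = mirror_step c s'"
  then have "vadd (fst s) (snd s) = vadd (fst s') (snd s')"
    "reflect (c (vadd (fst s) (snd s))) (snd s) = reflect (c (vadd (fst s) (snd s))) (snd s')"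
    by (auto simp: mirror_step_eq)
  moreover from this(2) have "snd s = snd s'" by (metis reflect_reflect)
  ultimately show "s = s'" by (auto simp: vadd_def prod_eq_iff)
qed

context
  fixes c :: "vtx \<Rightarrow> mirror" and v d :: vtx
  assumes d: "d \<in> set dirs"
begin

private definition "pos i = fst ((mirror_step c ^^ i) (v, d))"
private definition "dir i = snd ((mirror_step c ^^ i) (v, d))"

private lemma pos_Suc: "pos (Suc i) = vadd (pos i) (dir i)"
  and dir_Suc: "dir (Suc i) = reflect (c (pos (Suc i))) (dir i)"
  by (simp_all add: pos_def dir_def mirror_step_eq)

private lemma dir_dirs: "dir i \<in> set dirs"
  using d by (simp add: dir_def)

text \<open>A first backward traversal would, by time reversal, force a shorter one in between,
  and eventually a reversal at a single edge or vertex.\<close>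
private lemma no_reversal: "\<not> (dir (a + k) = vneg (dir a) \<and> pos (a + k) = pos (Suc a))"
proof (induction k arbitrary: a rule: less_induct)
  case (less k)
  consider "k = 0" | "k = 1" | j where "k = Suc (Suc j)" by (metis One_nat_def not0_implies_Suc)
  then show ?case
  proof cases
    case 1
    then show ?thesis using vneg_neq[OF dir_dirs[of a]] by auto
  next
    case 2
    then show ?thesis using reflect_neq_vneg[OF dir_dirs[of a]] by (simp add: dir_Suc)
  next
    case 3
    show ?thesis
    proof
      assume A: "dir (a + k) = vneg (dir a) \<and> pos (a + k) = pos (Suc a)"
      \<comment> \<open>Step \<open>?b\<close>, just before the reversal, turns out to reverse step
        \<open>Suc a\<close>; the gap \<open>k\<close> shrinks by 2.\<close>
      let ?b = "Suc a + j"
      have b: "a + k = Suc ?b" using 3 by simp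
      let ?m = "c (pos (Suc a))"
      have "reflect ?m (dir ?b) = vneg (dir a)" using A dir_Suc[of ?b] b by simp
      then have "dir ?b = reflect ?m (vneg (dir a))" by (metis reflect_reflect)
      then have D: "dir ?b = vneg (dir (Suc a))" by (simp add: reflect_vneg dir_Suc[of a])
      have P: "pos (Suc ?b) = pos (Suc a)" using A unfolding b by blast
      have "pos ?b = vadd (pos (Suc ?b)) (vneg (dir ?b))" by (simp only: pos_Suc[of ?b] vneg_simps)
      also have "\<dots> = pos (Suc (Suc a))" unfolding P D vneg_simps by (rule pos_Suc[symmetric])
      finally show False using less.IH[of j "Suc a"] D 3 by simp
    qed
  qed
qed

private lemma used_edges_orbit: "used_edges ([v] @ orbit_path c v d n) = {{pos i, pos (Suc i)} |i. i < n}"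
proof (induction n)
  case (Suc n)
  have "used_edges ([v] @ orbit_path c v d (Suc n)) = insert {pos n, pos (Suc n)} (used_edges ([v] @ orbit_path c v d n))"
    using used_edges_snoc[of "[v] @ orbit_path c v d n" "pos (Suc n)"] last_orbit_path[of v c d n]
    by (simp add: orbit_path_Suc pos_def)
  then show ?case using Suc by (auto simp: less_Suc_eq)
qed simp

text \<open>A repeated edge is crossed either in the same direction, which repeats a state and so
  makes the orbit periodic, or in the opposite direction, which \<open>no_reversal\<close> excludes.
  Conversely, after a period the first edge is crossed again.\<close>

lemma greedy_orbit_iff: "(\<forall>n. orbit_path c v d n \<in> greedy_exts [v] n) \<longleftrightarrow> \<not> periodic_orbit c v d"
proof
  assume g: "\<forall>n. orbit_path c v d n \<in> greedy_exts [v] n"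
  show "\<not> periodic_orbit c v d"
  proof
    assume "periodic_orbit c v d"
    then obtain k where k: "k > 0" "(mirror_step c ^^ k) (v, d) = (v, d)" by (auto simp: periodic_orbit_def)
    have "orbit_path c v d k @ [pos (Suc k)] \<in> greedy_exts [v] (Suc k)"
      using g[rule_format, of "Suc k"] by (simp only: orbit_path_Suc pos_def)
    then have "pos (Suc k) \<in> set (fresh_nbrs ([v] @ orbit_path c v d k))" unfolding greedy_exts_snoc by blast
    moreover have "last ([v] @ orbit_path c v d k) = pos k" using last_orbit_path[of v c d k] by (simp add: pos_def)
    ultimately have "{pos k, pos (Suc k)} \<notin> used_edges ([v] @ orbit_path c v d k)"
      unfolding set_fresh by auto
    moreover have "pos k = pos 0" "dir k = dir 0" using k by (simp_all add: pos_def dir_def)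
    moreover from this have "pos (Suc k) = pos (Suc 0)" by (simp only: pos_Suc)
    ultimately show False unfolding used_edges_orbit using k(1) by auto
  qed
next
  assume np: "\<not> periodic_orbit c v d"
  \<comment> \<open>Since the step is injective, equal states at times \<open>i < n\<close> pull
    back to a return to the start after \<open>n - i\<close> steps.\<close>
  have ni: False if "i < n" "pos n = pos i" "dir n = dir i" for i n
  proof -
    have "(mirror_step c ^^ i) ((mirror_step c ^^ (n - i)) (v, d)) = (mirror_step c ^^ n) (v, d)"
      using that(1) by (simp add: funpow_add[symmetric, THEN fun_cong, unfolded comp_def])
    also have "\<dots> = (mirror_step c ^^ i) (v, d)" using that by (simp add: pos_def dir_def prod_eq_iff)
    finally have "(mirror_step c ^^ (n - i)) (v, d) = (v, d)"
      using inj_fn[OF inj_mirror_step, of i c] by (blast dest: injD)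
    then show False using np that(1) unfolding periodic_orbit_def by (metis zero_less_diff)
  qed
  show "\<forall>n. orbit_path c v d n \<in> greedy_exts [v] n"
  proof
    fix n show "orbit_path c v d n \<in> greedy_exts [v] n"
    proof (induction n)
      case (Suc n)
      have l: "last ([v] @ orbit_path c v d n) = pos n" using last_orbit_path[of v c d n] by (simp add: pos_def)
      have "{pos n, pos (Suc n)} \<notin> used_edges ([v] @ orbit_path c v d n)"
      proof
        assume "{pos n, pos (Suc n)} \<in> used_edges ([v] @ orbit_path c v d n)"
        then obtain i where i: "i < n" "{pos n, pos (Suc n)} = {pos i, pos (Suc i)}"
          unfolding used_edges_orbit by blast
        then consider "pos n = pos i" "pos (Suc n) = pos (Suc i)" | "pos n = pos (Suc i)" "pos (Suc n) = pos i"
          unfolding doubleton_eq_iff by blast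
        then show False
        proof cases
          case 1
          then show False using ni[OF i(1)] by (simp add: pos_Suc)
        next
          case 2
          then have "vadd (vadd (pos i) (dir i)) (dir n) = pos i" by (simp add: pos_Suc)
          then have "dir n = vneg (dir i)" by (auto simp: vadd_def vneg_def prod_eq_iff)
          then show False using no_reversal[of i "n - i"] i(1) 2(1) by simp
        qed
      qed
      then have "pos (Suc n) \<in> set (fresh_nbrs ([v] @ orbit_path c v d n))"
        unfolding set_fresh l using dir_dirs[of n] pos_Suc[of n]
        by (intro CollectI exI[of _ "dir n"] conjI) simp_all
      then have "orbit_path c v d n @ [pos (Suc n)] \<in> greedy_exts [v] (Suc n)"
        unfolding greedy_exts_snoc using Suc by blast
      then show ?case by (simp only: orbit_path_Suc pos_def)
    qed simp
  qed
qed

end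

text \<open>The cell holding the next coin may depend on the whole history. The time-indexed walk
  \<open>grw_hist\<close> and the two-tape walk are both instances.\<close>

fun tape_hist :: "(vtx list \<Rightarrow> 'i) \<Rightarrow> ('i \<Rightarrow> nat) \<Rightarrow> nat \<Rightarrow> vtx list" where
  "tape_hist loc \<omega> 0 = [(0,0)]"
| "tape_hist loc \<omega> (Suc t) = (let hs = tape_hist loc \<omega> t; cs = grw_candidates hs
    in hs @ [cs ! (\<omega> (loc hs) mod length cs)])"

lemma length_tape_hist [simp]: "length (tape_hist loc \<omega> t) = Suc t"
  by (induction t) (simp_all add: Let_def)

lemma tape_hist_neq_Nil [simp]: "tape_hist loc \<omega> t \<noteq> []"
  using length_tape_hist[of loc \<omega> t] by (metis list.size(3) nat.simps(3))

lemma grw_hist_eq_tape_hist: "grw_hist \<omega> t = tape_hist (\<lambda>h. length h - 1) \<omega> t"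
proof (induction t)
  case (Suc t)
  then show ?case using length_tape_hist[of "\<lambda>h. length h - 1" \<omega> t] by (simp add: Let_def)
qed simp

lemma nth_candidates: "grw_candidates q ! (k mod length (grw_candidates q)) \<in> set (grw_candidates q)"
  using length_candidates[of q] by (intro nth_mem mod_less_divisor) auto

lemma tape_hist_Suc_greedy:
  assumes "fresh_nbrs (tape_hist loc \<omega> t) \<noteq> []"
  shows "\<exists>x\<in>set (fresh_nbrs (tape_hist loc \<omega> t)). tape_hist loc \<omega> (Suc t) = tape_hist loc \<omega> t @ [x]"
  using nth_candidates[of "tape_hist loc \<omega> t" "\<omega> (loc (tape_hist loc \<omega> t))"] assms
  by (simp add: Let_def grw_candidates_eq)

lemma greedy_run_imp_exts:
  assumes "tape_hist loc \<omega> T = h" "\<forall>s<n. fresh_nbrs (tape_hist loc \<omega> (T + s)) \<noteq> []"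
  shows "\<exists>p\<in>greedy_exts h n. tape_hist loc \<omega> (T + n) = h @ p"
  using assms(2)
proof (induction n)
  case 0
  then show ?case using assms(1) by simp
next
  case (Suc n)
  then obtain p where p: "p \<in> greedy_exts h n" "tape_hist loc \<omega> (T + n) = h @ p" by auto
  have "fresh_nbrs (h @ p) \<noteq> []" using Suc.prems[rule_format, of n] p(2) by simp
  then obtain x where x: "x \<in> set (fresh_nbrs (h @ p))" "tape_hist loc \<omega> (Suc (T + n)) = h @ p @ [x]"
    using tape_hist_Suc_greedy[of loc \<omega> "T + n"] unfolding p(2) append_assoc by blast
  have "p @ [x] \<in> greedy_exts h (Suc n)" unfolding greedy_exts_snoc using p x by blast
  then show ?case using x(2) by (metis add_Suc_right)
qed

lemma exts_imp_greedy_run: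
  assumes "tape_hist loc \<omega> n = (0,0) # p" "p \<in> greedy_exts [(0,0)] n" "s < n"
  shows "fresh_nbrs (tape_hist loc \<omega> s) \<noteq> []"
  using assms
proof (induction n arbitrary: p)
  case (Suc n)
  then obtain p' x where p: "p = p' @ [x]" "p' \<in> greedy_exts [(0,0)] n" "x \<in> set (fresh_nbrs ([(0,0)] @ p'))" by auto
  have h: "tape_hist loc \<omega> n = (0,0) # p'"
    using Suc.prems(1) p(1) by (simp add: Let_def)
  show ?case
  proof (cases "s = n")
    case True
    then show ?thesis using p(3) h by auto
  next
    case False
    then show ?thesis using Suc.IH[OF h p(2)] Suc.prems(3) by simp
  qed
qed simp

text \<open>Every departure from \<open>v\<close> uses up one of its four edges, so five visits are
  impossible.\<close>

lemma finite_visits_if_greedy: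
  assumes "\<forall>t. fresh_nbrs (tape_hist loc \<omega> t) \<noteq> []"
  shows "finite {t. last (tape_hist loc \<omega> t) = v}"
proof (rule ccontr)
  let ?H = "tape_hist loc \<omega>"
  assume "infinite {t. last (?H t) = v}"
  then obtain F where F: "F \<subseteq> {t. last (?H t) = v}" "finite F" "card F = 5"
    by (meson infinite_arbitrarily_large)
  have B: "card {s. s < t \<and> last (?H s) = v} \<le> used_degree (?H t) v" for t
  proof (induction t)
    case (Suc t)
    obtain x where x: "x \<in> set (fresh_nbrs (?H t))" "?H (Suc t) = ?H t @ [x]"
      using tape_hist_Suc_greedy assms by blast
    have "used_degree (?H (Suc t)) v = used_degree (?H t) v + (if v = last (?H t) \<or> v = x then 1 else 0)"
      unfolding x(2) by (rule used_degree_snoc[OF _ x(1)]) simp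
    moreover have "{s. s < Suc t \<and> last (?H s) = v} =
        (if last (?H t) = v then insert t {s. s < t \<and> last (?H s) = v} else {s. s < t \<and> last (?H s) = v})"
      by (auto simp: less_Suc_eq)
    ultimately show ?case using Suc by (cases "last (?H t) = v") auto
  qed simp
  have "F \<subseteq> {s. s < Suc (Max F) \<and> last (?H s) = v}" using F by (auto simp: less_Suc_eq_le)
  then have "card F \<le> card {s. s < Suc (Max F) \<and> last (?H s) = v}" by (intro card_mono) auto
  also have "\<dots> \<le> used_degree (?H (Suc (Max F))) v" by (rule B)
  also have "\<dots> \<le> card (set dirs)" unfolding used_degree_def by (intro card_mono) auto
  also have "\<dots> = 4" by (simp add: dirs_def)
  finally show False using F by simp
qed

section \<open>Greedy excursions and the two tapes\<close>

definition rounds :: "vtx list \<Rightarrow> nat" where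
  "rounds q = card {i. Suc i < length q \<and> fresh_nbrs (take (Suc i) q) = []}"

lemma rounds_single [simp]: "rounds [x] = 0"
  by (simp add: rounds_def)

lemma rounds_snoc:
  assumes "q \<noteq> []"
  shows "rounds (q @ [x]) = rounds q + (if fresh_nbrs q = [] then 1 else 0)"
proof -
  obtain l where l: "length q = Suc l" using assms by (cases q) auto
  have "{i. Suc i < length (q @ [x]) \<and> fresh_nbrs (take (Suc i) (q @ [x])) = []} =
    {i. Suc i < length q \<and> fresh_nbrs (take (Suc i) q) = []} \<union> (if fresh_nbrs q = [] then {l} else {})"
    using l by (auto simp: less_Suc_eq)
  then show ?thesis unfolding rounds_def using l by (simp add: card_insert_if)
qed

text \<open>As \<open>rounds\<close> counts the non-greedy steps made so far, these read
  \<open>Inr 0\<close>, \<open>Inr 1\<close>, ... in order and without gaps. Greedy steps are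
  addressed by the length of the history, which leaves gaps but never repeats.\<close>

definition two_tape_loc :: "vtx list \<Rightarrow> nat + nat" where
  "two_tape_loc h = (if fresh_nbrs h = [] then Inr (rounds h) else Inl (length h))"

lemma two_tape_loc_neq:
  assumes "i < j" "j < length q"
  shows "two_tape_loc (take (Suc i) q) \<noteq> two_tape_loc (take (Suc j) q)"
proof -
  have "rounds (take (Suc i) q) < rounds (take (Suc j) q)" if "fresh_nbrs (take (Suc i) q) = []"
    unfolding rounds_def
  proof (rule psubset_card_mono)
    show "{k. Suc k < length (take (Suc i) q) \<and> fresh_nbrs (take (Suc k) (take (Suc i) q)) = []}
      \<subset> {k. Suc k < length (take (Suc j) q) \<and> fresh_nbrs (take (Suc k) (take (Suc j) q)) = []}"
      (is "?A \<subset> ?B")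
    proof
      show "?A \<subseteq> ?B" using assms by (auto simp: min_def)
      have "i \<in> ?B" "i \<notin> ?A" using assms that by (auto simp: min_def)
      then show "?A \<noteq> ?B" by blast
    qed
  qed simp
  then show ?thesis using assms by (auto simp: two_tape_loc_def)
qed

fun srw :: "(nat \<Rightarrow> nat) \<Rightarrow> nat \<Rightarrow> vtx" where
  "srw \<beta> 0 = (0,0)"
| "srw \<beta> (Suc k) = vadd (srw \<beta> k) (dirs ! (\<beta> k mod 4))"

text \<open>The current greedy excursion began at S (rounds (H t)); by parity it can only get stuck there.\<close>
lemma odd_used_degree_iff:
  fixes \<omega> :: "nat + nat \<Rightarrow> nat"
  defines "H \<equiv> tape_hist two_tape_loc \<omega>" and "S \<equiv> srw (\<lambda>k. \<omega> (Inr k))"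
  shows "odd (used_degree (H t) u) \<longleftrightarrow> (u = last (H t)) \<noteq> (u = S (rounds (H t)))"
    and "fresh_nbrs (H t) = [] \<Longrightarrow> last (H (Suc t)) = S (rounds (H (Suc t)))"
proof -
  \<comment> \<open>Stuck means degree 4 at the current vertex. As 4 is even, the parity claim says
    that the excursion ended where it began. The walk and \<open>S\<close> then make the same move,
    both read from the cell \<open>Inr (rounds (H t))\<close>.\<close>
  have stuck: "last (H t) = S (rounds (H t)) \<and> last (H (Suc t)) = S (rounds (H (Suc t)))"
    if f: "fresh_nbrs (H t) = []"
      and o: "\<And>u. odd (used_degree (H t) u) \<longleftrightarrow> (u = last (H t)) \<noteq> (u = S (rounds (H t)))" for t
  proof -
    have "used_degree (H t) (last (H t)) = 4" using length_fresh[of "H t"] f by simp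
    then have 1: "last (H t) = S (rounds (H t))" using o[of "last (H t)"] by simp
    have "rounds (H (Suc t)) = Suc (rounds (H t))"
      using f by (simp add: H_def Let_def rounds_snoc)
    moreover have "last (H (Suc t)) = vadd (last (H t)) (dirs ! (\<omega> (Inr (rounds (H t))) mod 4))"
      using f by (simp add: H_def Let_def grw_candidates_eq two_tape_loc_def)
    ultimately show ?thesis using 1 by (simp add: S_def)
  qed
  have main: "odd (used_degree (H t) u) \<longleftrightarrow> (u = last (H t)) \<noteq> (u = S (rounds (H t)))" for u t
  proof (induction t arbitrary: u)
    case 0
    then show ?case by (simp add: H_def S_def used_degree_def)
  next
    case (Suc t)
    show ?case
    proof (cases "fresh_nbrs (H t) = []")
      case True
      obtain x where x: "x \<in> set (grw_candidates (H t))" "H (Suc t) = H t @ [x]"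
        using nth_candidates[of "H t" "\<omega> (two_tape_loc (H t))"] by (simp add: H_def Let_def)
      have "{last (H t), x} \<in> used_edges (H t)"
        using x(1) True by (auto simp: grw_candidates_eq fresh_nbrs_def filter_empty_conv)
      then have "used_edges (H (Suc t)) = used_edges (H t)"
        using used_edges_snoc[of "H t" x] x(2) by (simp add: H_def insert_absorb)
      then have "used_degree (H (Suc t)) u = used_degree (H t) u" by (simp add: used_degree_def)
      then show ?thesis using stuck[OF True Suc] Suc[of u] by simp
    next
      case False
      obtain x where x: "x \<in> set (fresh_nbrs (H t))" "H (Suc t) = H t @ [x]"
        using tape_hist_Suc_greedy False unfolding H_def by blast
      have "x \<noteq> last (H t)" using x(1) by (auto simp: set_fresh)
      moreover have "used_degree (H (Suc t)) u = used_degree (H t) u + (if u = last (H t) \<or> u = x then 1 else 0)"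
        unfolding x(2) by (rule used_degree_snoc[OF _ x(1)]) (simp add: H_def)
      moreover have "rounds (H (Suc t)) = rounds (H t)"
        unfolding x(2) using False by (subst rounds_snoc) (simp_all add: H_def)
      ultimately show ?thesis using Suc[of u] x(2) by auto
    qed
  qed
  show "odd (used_degree (H t) u) \<longleftrightarrow> (u = last (H t)) \<noteq> (u = S (rounds (H t)))" by (rule main)
  show "fresh_nbrs (H t) = [] \<Longrightarrow> last (H (Suc t)) = S (rounds (H (Suc t)))" using stuck main by blast
qed

text \<open>Round \<open>m\<close> begins at \<open>S m\<close>, and every round begins because
  every excursion ends. Different returns of \<open>S\<close> give different times of the walk,
  since \<open>rounds\<close> recovers \<open>m\<close> from the time.\<close>

lemma two_tape_recurrent:
  fixes \<omega> :: "nat + nat \<Rightarrow> nat"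
  defines "H \<equiv> tape_hist two_tape_loc \<omega>" and "S \<equiv> srw (\<lambda>k. \<omega> (Inr k))"
  assumes fr: "\<And>T. \<exists>t\<ge>T. fresh_nbrs (H t) = []"
    and rec: "infinite {k. S k = (0,0)}"
  shows "infinite {t. last (H t) = (0,0)}"
proof -
  have R: "rounds (H (Suc t)) = rounds (H t) + (if fresh_nbrs (H t) = [] then 1 else 0)" for t
    by (simp add: H_def Let_def rounds_snoc)
  have hit: "\<exists>t. rounds (H t) = m \<and> last (H t) = S m" for m
  proof (induction m)
    case 0
    then show ?case by (intro exI[of _ 0]) (simp add: H_def S_def)
  next
    case (Suc m)
    then obtain t0 where t0: "rounds (H t0) = m" by blast
    define t where "t = (LEAST t. t \<ge> t0 \<and> fresh_nbrs (H t) = [])"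
    have t: "t \<ge> t0" "fresh_nbrs (H t) = []"
      using fr[of t0] LeastI_ex[of "\<lambda>t. t \<ge> t0 \<and> fresh_nbrs (H t) = []"] unfolding t_def by blast+
    have before: "fresh_nbrs (H s) \<noteq> []" if "t0 \<le> s" "s < t" for s
      using that not_less_Least[of s "\<lambda>t. t \<ge> t0 \<and> fresh_nbrs (H t) = []"] unfolding t_def by blast
    have "t0 + k \<le> t \<Longrightarrow> rounds (H (t0 + k)) = m" for k
      using before by (induction k) (simp_all add: t0 R)
    from this[of "t - t0"] have "rounds (H t) = m" using t(1) by simp
    then have r: "rounds (H (Suc t)) = Suc m" using R t(2) by simp
    moreover have "last (H (Suc t)) = S (Suc m)"
      using odd_used_degree_iff(2)[of \<omega> t] t(2) r unfolding H_def S_def by simp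
    ultimately show ?case by blast
  qed
  then obtain \<tau> where \<tau>: "\<And>m. rounds (H (\<tau> m)) = m" "\<And>m. last (H (\<tau> m)) = S m" by metis
  have "inj \<tau>" using \<tau>(1) by (metis injI)
  then have "infinite (\<tau> ` {k. S k = (0,0)})" using rec by (simp add: finite_image_iff inj_on_subset)
  moreover have "\<tau> ` {k. S k = (0,0)} \<subseteq> {t. last (H t) = (0,0)}" using \<tau>(2) by auto
  ultimately show ?thesis using finite_subset by blast
qed

section \<open>The law of the history\<close>

definition iid_space :: "'a pmf \<Rightarrow> ('i \<Rightarrow> 'a) measure" where
  "iid_space p = PiM UNIV (\<lambda>_. measure_pmf p)"

abbreviation die :: "nat pmf" where
  "die \<equiv> pmf_of_set {..<12}"

lemma grw_space_eq: "grw_space = iid_space die"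
  by (simp add: grw_space_def iid_space_def)

lemma mirror_space_eq: "mirror_space = iid_space (pmf_of_set {Slash, Backslash, NoMirror})"
  by (simp add: mirror_space_def iid_space_def)

lemma space_iid_space [simp]: "space (iid_space p) = UNIV"
  by (simp add: iid_space_def space_PiM)

lemma prob_space_iid_space: "prob_space (iid_space p)"
  unfolding iid_space_def by (intro prob_space_PiM prob_space_measure_pmf)

lemma measurable_iid_coord: "(\<lambda>\<omega>. \<omega> i) \<in> measurable (iid_space p) (count_space UNIV)"
  unfolding iid_space_def
  using measurable_component_singleton[of i UNIV "\<lambda>_. measure_pmf p"] by simp

lemma iid_event:
  "f \<in> measurable (iid_space p) (count_space UNIV) \<Longrightarrow> {\<omega>. P (f \<omega>)} \<in> sets (iid_space p)"
  using measurable_sets[of f "iid_space p" "count_space UNIV" "Collect P"] by (simp add: vimage_def)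

lemma measure_iid_cylinder:
  assumes "finite J"
  shows "measure (iid_space p) {\<omega>. \<forall>j\<in>J. \<omega> j \<in> A j} = (\<Prod>j\<in>J. measure (measure_pmf p) (A j))"
proof -
  interpret product_prob_space "\<lambda>_. measure_pmf p" UNIV by standard
  have "measure (iid_space p) (prod_emb UNIV (\<lambda>_. measure_pmf p) J (Pi\<^sub>E J A)) = (\<Prod>j\<in>J. measure (measure_pmf p) (A j))"
    unfolding iid_space_def using assms by (intro measure_PiM_emb) auto
  also have "prod_emb UNIV (\<lambda>_. measure_pmf p) J (Pi\<^sub>E J A) = {\<omega>. \<forall>j\<in>J. \<omega> j \<in> A j}"
    by (auto simp: prod_emb_def space_PiM)
  finally show ?thesis .
qed

lemma prob_die_mod:
  assumes "L \<in> {1, 2, 3, 4::nat}" "k < L"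
  shows "measure (measure_pmf die) {u. u mod L = k} = 1 / real L"
proof -
  have "measure (measure_pmf die) {u. u mod L = k} = real (card ({..<12} \<inter> {u. u mod L = k})) / 12"
    by (subst measure_pmf_of_set) (simp_all add: lessThan_empty_iff)
  also have "{..<12} \<inter> {u. u mod L = k} = set (filter (\<lambda>u. u mod L = k) [0..<12])"
    unfolding set_filter set_upt by auto
  also have "card \<dots> = length (filter (\<lambda>u. u mod L = k) [0..<12])"
    by (intro distinct_card distinct_filter distinct_upt)
  also have "[0..<12] = [0,1,2,3,4,5,6,7,8,9,10,11::nat]" by (simp add: upt_rec)
  also have "real (length (filter (\<lambda>u. u mod L = k) \<dots>)) / 12 = 1 / real L"
  proof -
    have L: "L = 1 \<or> L = 2 \<or> L = 3 \<or> L = 4" using assms by auto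
    show ?thesis using L
    proof (elim disjE)
      assume "L = 1" then show ?thesis using assms(2) by simp
    next
      assume L: "L = 2"
      then have "k = 0 \<or> k = 1" using assms(2) by linarith
      then show ?thesis unfolding L by (elim disjE) simp_all
    next
      assume L: "L = 3"
      then have "k = 0 \<or> k = 1 \<or> k = 2" using assms(2) by linarith
      then show ?thesis unfolding L by (elim disjE) simp_all
    next
      assume L: "L = 4"
      then have "k = 0 \<or> k = 1 \<or> k = 2 \<or> k = 3" using assms(2) by linarith
      then show ?thesis unfolding L by (elim disjE) simp_all
    qed
  qed
  finally show ?thesis .
qed

lemma prob_die_choice:
  assumes "distinct cs" "length cs \<in> {1, 2, 3, 4}"
  shows "measure (measure_pmf die) {u. cs ! (u mod length cs) = x} =
    (if x \<in> set cs then 1 / real (length cs) else 0)"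
proof (cases "x \<in> set cs")
  case True
  then obtain k where k: "k < length cs" "x = cs ! k" by (metis in_set_conv_nth)
  have "u mod length cs < length cs" for u using k(1) by (intro mod_less_divisor) linarith
  then have "{u. cs ! (u mod length cs) = x} = {u. u mod length cs = k}"
    using nth_eq_iff_index_eq[OF assms(1)] k by auto
  then show ?thesis using prob_die_mod[OF assms(2) k(1)] True by simp
next
  case False
  have "u mod length cs < length cs" for u using assms(2) by (intro mod_less_divisor) auto
  then have "{u. cs ! (u mod length cs) = x} = {}" using False nth_mem by blast
  then show ?thesis using False by simp
qed

section \<open>Measurability of histories and orbits\<close>

lemma measurable_tape_hist:
  "(\<lambda>\<omega>. tape_hist loc \<omega> t) \<in> measurable (iid_space p) (count_space UNIV)"
proof (induction t)
  case 0
  show ?case unfolding tape_hist.simps by (rule measurable_const) simp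
next
  case (Suc t)
  have "(\<lambda>\<omega>. h @ [grw_candidates h ! (\<omega> (loc h) mod length (grw_candidates h))])
      \<in> measurable (iid_space p) (count_space UNIV)" for h
    by (rule measurable_compose[OF measurable_iid_coord[of "loc h"]]) simp
  from measurable_compose_countable[OF this Suc] show ?case unfolding tape_hist.simps Let_def .
qed

lemma measurable_orbit:
  "(\<lambda>c. (mirror_step c ^^ n) s) \<in> measurable mirror_space (count_space UNIV)"
proof (induction n)
  case 0
  show ?case unfolding funpow.simps id_apply by (rule measurable_const) simp
next
  case (Suc n)
  have "(\<lambda>c. mirror_step c s) \<in> measurable mirror_space (count_space UNIV)" for s
    unfolding mirror_step_eq mirror_space_eq
    by (rule measurable_compose[OF measurable_iid_coord[of "vadd (fst s) (snd s)"]]) simp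
  from measurable_compose_countable[OF this Suc] show ?case by simp
qed

lemma measurable_orbit_path:
  "(\<lambda>c. orbit_path c v d n) \<in> measurable mirror_space (count_space UNIV)"
proof (induction n)
  case 0
  show ?case unfolding orbit_path_0 by (rule measurable_const) simp
next
  case (Suc n)
  have "(\<lambda>c. h @ [fst ((mirror_step c ^^ Suc n) (v, d))]) \<in> measurable mirror_space (count_space UNIV)" for h
    by (rule measurable_compose[OF measurable_orbit]) simp
  from measurable_compose_countable[OF this Suc] show ?case by (simp add: orbit_path_Suc)
qed

text \<open>What makes successive coins independent although their cells are chosen adaptively:
  along one history no cell is read twice.\<close>

definition reads_once :: "(vtx list \<Rightarrow> 'i) \<Rightarrow> bool" where
  "reads_once loc \<longleftrightarrow> (\<forall>q i j. i < j \<longrightarrow> j < length q \<longrightarrow> loc (take (Suc i) q) \<noteq> loc (take (Suc j) q))"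

lemma reads_once_length: "reads_once (\<lambda>h. length h - 1)"
  unfolding reads_once_def
proof (intro allI impI)
  fix q :: "vtx list" and i j assume "i < j" "j < length q"
  then have "length (take (Suc i) q) = Suc i" "length (take (Suc j) q) = Suc j" by simp_all
  then show "length (take (Suc i) q) - 1 \<noteq> length (take (Suc j) q) - 1" using \<open>i < j\<close> by (simp only:)
qed

lemma reads_once_two_tape: "reads_once two_tape_loc"
  unfolding reads_once_def by (intro allI impI two_tape_loc_neq)

text \<open>A prescribed history determines the cells \<open>J q\<close> read on the way, so it is a
  cylinder event. The cell of the last step is new, so its constraint is added without disturbing
  the others and the probabilities multiply.\<close>

lemma tape_hist_cylinder:
  assumes ro: "reads_once loc" and "length q = Suc t" "hd q = (0,0)"
  defines "J \<equiv> \<lambda>q. (\<lambda>i. loc (take (Suc i) q)) ` {..<length q - 1}"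
  shows "\<exists>A. {\<omega>. tape_hist loc \<omega> t = q} = {\<omega>. \<forall>j\<in>J q. \<omega> j \<in> A j} \<and>
    (\<Prod>j\<in>J q. measure (measure_pmf die) (A j)) = weight q"
  using assms(2,3)
proof (induction t arbitrary: q)
  case 0
  then have "q = [(0,0)]" by (cases q) auto
  then show ?case by (simp add: J_def)
next
  case (Suc t)
  define r x where "r = butlast q" and "x = last q"
  have q: "q = r @ [x]" using Suc.prems(1) by (cases q rule: rev_cases) (auto simp: r_def x_def)
  have lr: "length r = Suc t" using Suc.prems(1) q by simp
  then have rn: "r \<noteq> []" by auto
  have "hd r = (0,0)" using Suc.prems(2) q rn by simp
  then obtain A where A: "{\<omega>. tape_hist loc \<omega> t = r} = {\<omega>. \<forall>j\<in>J r. \<omega> j \<in> A j}"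
    "(\<Prod>j\<in>J r. measure (measure_pmf die) (A j)) = weight r"
    using Suc.IH lr by blast
  have Jq: "J q = insert (loc r) (J r)"
  proof -
    have "J q = (\<lambda>i. loc (take (Suc i) q)) ` insert t {..<t}"
      using lr q by (simp add: J_def lessThan_Suc)
    also have "\<dots> = insert (loc r) ((\<lambda>i. loc (take (Suc i) r)) ` {..<t})"
      using lr q by auto
    finally show ?thesis using lr by (simp add: J_def)
  qed
  have nin: "loc r \<notin> J r"
  proof
    assume "loc r \<in> J r"
    then obtain i where "i < t" "loc (take (Suc i) r) = loc (take (Suc t) r)" using lr by (auto simp: J_def)
    then show False using ro lr unfolding reads_once_def by (metis lessI)
  qed
  let ?cs = "grw_candidates r"
  let ?A = "A(loc r := {u. ?cs ! (u mod length ?cs) = x})"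
  have "{\<omega>. tape_hist loc \<omega> (Suc t) = q} = {\<omega>. tape_hist loc \<omega> t = r} \<inter> {\<omega>. ?cs ! (\<omega> (loc r) mod length ?cs) = x}"
    by (auto simp: q Let_def)
  also have "\<dots> = {\<omega>. \<forall>j\<in>J q. \<omega> j \<in> ?A j}"
    unfolding A(1) Jq using nin by auto
  finally have 1: "{\<omega>. tape_hist loc \<omega> (Suc t) = q} = {\<omega>. \<forall>j\<in>J q. \<omega> j \<in> ?A j}" .
  have "(\<Prod>j\<in>J q. measure (measure_pmf die) (?A j)) =
      measure (measure_pmf die) {u. ?cs ! (u mod length ?cs) = x} * (\<Prod>j\<in>J r. measure (measure_pmf die) (?A j))"
    unfolding Jq using nin by (subst prod.insert) (simp_all add: J_def)
  also have "(\<Prod>j\<in>J r. measure (measure_pmf die) (?A j)) = weight r"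
    unfolding A(2)[symmetric] using nin by (intro prod.cong) auto
  also have "measure (measure_pmf die) {u. ?cs ! (u mod length ?cs) = x} * weight r = weight q"
    unfolding q weight_snoc[OF rn] using prob_die_choice[OF distinct_candidates length_candidates, of r x]
    by simp
  finally show ?case using 1 by blast
qed

text \<open>The right-hand side does not mention \<open>loc\<close>: all such addressings give
  finite histories the same law.\<close>

lemma prob_tape_hist:
  assumes "reads_once loc" "length q = Suc t" "hd q = (0,0)"
  shows "measure (iid_space die) {\<omega>. tape_hist loc \<omega> t = q} = weight q"
proof -
  obtain A where A: "{\<omega>. tape_hist loc \<omega> t = q} =
      {\<omega>. \<forall>j\<in>(\<lambda>i. loc (take (Suc i) q)) ` {..<length q - 1}. \<omega> j \<in> A j}"
    "(\<Prod>j\<in>(\<lambda>i. loc (take (Suc i) q)) ` {..<length q - 1}. measure (measure_pmf die) (A j)) = weight q"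
    using tape_hist_cylinder[OF assms] by blast
  show ?thesis unfolding A(1) by (subst measure_iid_cylinder) (simp, rule A(2))
qed

fun reachable :: "nat \<Rightarrow> vtx list set" where
  "reachable 0 = {[(0,0)]}"
| "reachable (Suc t) = (\<Union>q\<in>reachable t. (\<lambda>x. q @ [x]) ` set (grw_candidates q))"

lemma finite_reachable: "finite (reachable t)"
  by (induction t) auto

lemma reachable_shape: "q \<in> reachable t \<Longrightarrow> length q = Suc t \<and> hd q = (0,0)"
proof (induction t arbitrary: q)
  case (Suc t)
  then obtain r x where "q = r @ [x]" "length r = Suc t" "hd r = (0,0)" by auto
  then show ?case by (cases r) auto
qed simp

lemma tape_hist_reachable: "tape_hist loc \<omega> t \<in> reachable t"
proof (induction t)
  case (Suc t)
  then show ?case using nth_candidates by (auto simp: Let_def)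
qed simp

lemma prob_tape_hist_Collect:
  assumes "reads_once loc"
  shows "measure (iid_space die) {\<omega>. P (tape_hist loc \<omega> t)} = (\<Sum>q\<in>{q\<in>reachable t. P q}. weight q)"
proof -
  interpret prob_space "iid_space die" by (rule prob_space_iid_space)
  have "{\<omega>. P (tape_hist loc \<omega> t)} = (\<Union>q\<in>{q\<in>reachable t. P q}. {\<omega>. tape_hist loc \<omega> t = q})"
    using tape_hist_reachable by fastforce
  also have "measure (iid_space die) \<dots> = (\<Sum>q\<in>{q\<in>reachable t. P q}. measure (iid_space die) {\<omega>. tape_hist loc \<omega> t = q})"
    using finite_reachable iid_event[OF measurable_tape_hist]
    by (intro finite_measure_finite_Union) (auto simp: disjoint_family_on_def)
  also have "\<dots> = (\<Sum>q\<in>{q\<in>reachable t. P q}. weight q)"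
    using prob_tape_hist[OF assms] reachable_shape by (intro sum.cong) auto
  finally show ?thesis .
qed

text \<open>A later history contains all earlier positions, so an event about several times is a
  predicate of one history.\<close>

lemma nth_tape_hist: "t \<le> m \<Longrightarrow> tape_hist loc \<omega> m ! t = last (tape_hist loc \<omega> t)"
proof (induction m)
  case (Suc m)
  show ?case
  proof (cases "t = Suc m")
    case True
    show ?thesis unfolding True last_conv_nth[OF tape_hist_neq_Nil] length_tape_hist diff_Suc_1 ..
  next
    case False
    then show ?thesis using Suc by (simp add: Let_def nth_append)
  qed
qed simp

text \<open>Infinitely many visits cannot be read off a finite history. Its failure is a countable
  union over \<open>T\<close> of the events that no visit occurs from \<open>T\<close> on, and each
  of these is the decreasing limit of events determined by the history at time \<open>T + n\<close>,
  which have equal probabilities in both models.\<close>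

lemma AE_infinite_visits_transfer:
  fixes loc :: "vtx list \<Rightarrow> 'i" and loc' :: "vtx list \<Rightarrow> 'j"
  assumes ro: "reads_once loc" "reads_once loc'"
    and AE: "AE \<omega> in iid_space die. infinite {t. last (tape_hist loc \<omega> t) = v}"
  shows "AE \<omega> in iid_space die. infinite {t. last (tape_hist loc' \<omega> t) = v}"
proof -
  interpret M1: prob_space "iid_space die :: ('i \<Rightarrow> nat) measure" by (rule prob_space_iid_space)
  interpret M2: prob_space "iid_space die :: ('j \<Rightarrow> nat) measure" by (rule prob_space_iid_space)
  have "AE \<omega> in iid_space die. \<not> (\<forall>t\<ge>T. last (tape_hist loc' \<omega> t) \<noteq> v)" for T
  proof -
    define P where "P n q \<longleftrightarrow> (\<forall>t. T \<le> t \<longrightarrow> t \<le> T + n \<longrightarrow> q ! t \<noteq> v)" for n :: nat and q :: "vtx list"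
    define E where "E n = {\<omega>. P n (tape_hist loc \<omega> (T + n))}" for n
    define E' where "E' n = {\<omega>. P n (tape_hist loc' \<omega> (T + n))}" for n
    have E: "E n = {\<omega>. \<forall>t. T \<le> t \<longrightarrow> t \<le> T + n \<longrightarrow> last (tape_hist loc \<omega> t) \<noteq> v}" for n
      unfolding E_def P_def by (simp add: nth_tape_hist cong: imp_cong)
    have E': "E' n = {\<omega>. \<forall>t. T \<le> t \<longrightarrow> t \<le> T + n \<longrightarrow> last (tape_hist loc' \<omega> t) \<noteq> v}" for n
      unfolding E'_def P_def by (simp add: nth_tape_hist cong: imp_cong)
    have "E n \<in> sets (iid_space die)" "E' n \<in> sets (iid_space die)" for n
      unfolding E_def E'_def by (rule iid_event[OF measurable_tape_hist, where P = "P n"])+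
    then have mE: "range E \<subseteq> sets (iid_space die)" "range E' \<subseteq> sets (iid_space die)" by auto
    have dec: "decseq E" "decseq E'" unfolding E E' decseq_def by auto
    have gen: "(\<forall>n t. T \<le> t \<longrightarrow> t \<le> T + n \<longrightarrow> Q t) \<longleftrightarrow> (\<forall>t\<ge>T. Q t)" for Q
      by (meson le_add2)
    have I: "(\<Inter>n. E n) = {\<omega>. \<forall>t\<ge>T. last (tape_hist loc \<omega> t) \<noteq> v}"
      "(\<Inter>n. E' n) = {\<omega>. \<forall>t\<ge>T. last (tape_hist loc' \<omega> t) \<noteq> v}"
      unfolding E E' by (simp_all add: set_eq_iff gen)
    have eq: "measure (iid_space die) (E n) = measure (iid_space die) (E' n)" for n
      unfolding E_def E'_def by (simp add: prob_tape_hist_Collect ro)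
    have "AE \<omega> in iid_space die. \<omega> \<notin> (\<Inter>n. E n)"
      unfolding I using AE
    proof eventually_elim
      case (elim \<omega>)
      then obtain t where "t \<ge> T" "last (tape_hist loc \<omega> t) = v"
        by (metis (mono_tags, lifting) infinite_nat_iff_unbounded_le mem_Collect_eq)
      then show ?case by blast
    qed
    then have "measure (iid_space die) (\<Inter>n. E n) = 0"
      by (subst M1.prob_eq_0) (use mE(1) in auto)
    moreover have "(\<lambda>n. measure (iid_space die) (E n)) \<longlonglongrightarrow> measure (iid_space die) (\<Inter>n. E n)"
      by (rule M1.finite_Lim_measure_decseq[OF mE(1) dec(1)])
    moreover have "(\<lambda>n. measure (iid_space die) (E' n)) \<longlonglongrightarrow> measure (iid_space die) (\<Inter>n. E' n)"
      by (rule M2.finite_Lim_measure_decseq[OF mE(2) dec(2)])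
    ultimately have "measure (iid_space die) (\<Inter>n. E' n) = 0"
      unfolding eq using LIMSEQ_unique by fastforce
    moreover have "(\<Inter>n. E' n) \<in> sets (iid_space die)" using mE(2) by auto
    ultimately have "AE \<omega> in iid_space die. \<omega> \<notin> (\<Inter>n. E' n)"
      by (simp add: M2.prob_eq_0)
    then show ?thesis unfolding I by simp
  qed
  then have "AE \<omega> in iid_space die. \<forall>T. \<not> (\<forall>t\<ge>T. last (tape_hist loc' \<omega> t) \<noteq> v)"
    by (simp add: AE_all_countable)
  then show ?thesis
    by eventually_elim (auto simp: infinite_nat_iff_unbounded_le)
qed

section \<open>Comparison of orbits and greedy excursions\<close>

abbreviation mirror_pmf :: "mirror pmf" where
  "mirror_pmf \<equiv> pmf_of_set {Slash, Backslash, NoMirror}"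

lemma prob_mirror: "measure (measure_pmf mirror_pmf) {m} = 1 / 3"
  by (cases m) (simp_all add: measure_pmf_single)

lemma prob_orbit_path:
  assumes "p \<in> greedy_exts [v] (Suc n)" "d \<in> set dirs" "hd p = vadd v d"
  shows "measure mirror_space {c. orbit_path c v d (Suc n) = p} = (1/3) ^ card (set (butlast p))"
proof -
  obtain m where m: "{c. orbit_path c v d (Suc n) = p} = {c. \<forall>u\<in>set (butlast p). c u \<in> {m u}}"
    using orbit_path_follows[OF assms] by auto
  show ?thesis unfolding m mirror_space_eq
    by (subst measure_iid_cylinder) (simp_all add: prob_mirror)
qed

lemma hd_orbit_path: "hd (orbit_path c v d (Suc n)) = vadd v d"
  by (simp add: orbit_path_def upt_rec[of 0] mirror_step_eq del: upt_Suc)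

definition greedy_orbit :: "vtx \<Rightarrow> vtx \<Rightarrow> nat \<Rightarrow> (vtx \<Rightarrow> mirror) set" where
  "greedy_orbit v d n = {c. orbit_path c v d n \<in> greedy_exts [v] n}"

lemma sets_greedy_orbit: "greedy_orbit v d n \<in> sets mirror_space"
  unfolding greedy_orbit_def mirror_space_eq
  by (rule iid_event[OF measurable_orbit_path[unfolded mirror_space_eq], where P = "\<lambda>q. q \<in> greedy_exts [v] n"])

lemma prob_space_mirror: "prob_space mirror_space"
  unfolding mirror_space_eq by (rule prob_space_iid_space)

lemma prob_greedy_orbit:
  assumes "d \<in> set dirs"
  shows "measure mirror_space (greedy_orbit v d (Suc n)) =
    (\<Sum>p\<in>{p \<in> greedy_exts [v] (Suc n). hd p = vadd v d}. (1/3) ^ card (set (butlast p)))"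
proof -
  interpret prob_space mirror_space by (rule prob_space_mirror)
  let ?F = "{p \<in> greedy_exts [v] (Suc n). hd p = vadd v d}"
  have "greedy_orbit v d (Suc n) = (\<Union>p\<in>?F. {c. orbit_path c v d (Suc n) = p})"
    using hd_orbit_path unfolding greedy_orbit_def by blast
  also have "measure mirror_space \<dots> = (\<Sum>p\<in>?F. measure mirror_space {c. orbit_path c v d (Suc n) = p})"
  proof (rule finite_measure_finite_Union)
    have "{c. orbit_path c v d (Suc n) = p} \<in> sets mirror_space" for p
      unfolding mirror_space_eq
      by (rule iid_event[OF measurable_orbit_path[unfolded mirror_space_eq], where P = "\<lambda>q. q = p"])
    then show "(\<lambda>p. {c. orbit_path c v d (Suc n) = p}) ` ?F \<subseteq> events" by blast
  qed (auto simp: disjoint_family_on_def simp del: greedy_exts.simps)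
  also have "\<dots> = (\<Sum>p\<in>?F. (1/3) ^ card (set (butlast p)))"
    using prob_orbit_path[OF _ assms] by (intro sum.cong) auto
  finally show ?thesis .
qed

lemma greedy_orbit_INT:
  assumes "d \<in> set dirs"
  shows "(\<Inter>n. greedy_orbit v d n) = {c. \<not> periodic_orbit c v d}"
  by (simp add: greedy_orbit_def set_eq_iff greedy_orbit_iff[OF assms])

lemma decseq_greedy_orbit: "decseq (greedy_orbit v d)"
proof (rule decseq_SucI)
  fix n show "greedy_orbit v d (Suc n) \<subseteq> greedy_orbit v d n"
    unfolding greedy_orbit_def orbit_path_Suc greedy_exts_snoc by blast
qed

lemma greedy_orbit_LIMSEQ:
  assumes "d \<in> set dirs"
  shows "(\<lambda>n. measure mirror_space (greedy_orbit v d n)) \<longlonglongrightarrow> measure mirror_space {c. \<not> periodic_orbit c v d}"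
proof -
  interpret prob_space mirror_space by (rule prob_space_mirror)
  have "range (greedy_orbit v d) \<subseteq> events" using sets_greedy_orbit by blast
  from finite_Lim_measure_decseq[OF this decseq_greedy_orbit] show ?thesis
    by (simp only: greedy_orbit_INT[OF assms])
qed

lemma sets_nonperiodic:
  assumes "d \<in> set dirs"
  shows "{c. \<not> periodic_orbit c v d} \<in> sets mirror_space"
  unfolding greedy_orbit_INT[OF assms, symmetric] using sets_greedy_orbit by auto

lemma AE_periodic_iff:
  assumes "d \<in> set dirs"
  shows "(AE c in mirror_space. periodic_orbit c v d) \<longleftrightarrow> measure mirror_space {c. \<not> periodic_orbit c v d} = 0"
proof -
  interpret prob_space mirror_space by (rule prob_space_mirror)
  show ?thesis using prob_eq_0[OF sets_nonperiodic[OF assms, of v]] by simp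
qed

lemma sets_greedy_run:
  "{\<omega>. \<forall>s<n. fresh_nbrs (tape_hist loc \<omega> (T + s)) \<noteq> []} \<in> sets (iid_space die)"
proof -
  have "{\<omega>. fresh_nbrs (tape_hist loc \<omega> t) \<noteq> []} \<in> sets (iid_space die)" for t
    by (rule iid_event[OF measurable_tape_hist, where P = "\<lambda>q. fresh_nbrs q \<noteq> []"])
  then have "(\<Inter>s\<in>{..<n}. {\<omega>. fresh_nbrs (tape_hist loc \<omega> (T + s)) \<noteq> []}) \<in> sets (iid_space die)"
    if "n > 0" using that by (intro sets.finite_INT) auto
  moreover have "(\<Inter>s\<in>{..<n}. {\<omega>. fresh_nbrs (tape_hist loc \<omega> (T + s)) \<noteq> []}) =
    {\<omega>. \<forall>s<n. fresh_nbrs (tape_hist loc \<omega> (T + s)) \<noteq> []}" by auto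
  moreover have "UNIV \<in> sets (iid_space die)" using sets.top[of "iid_space die"] by simp
  ultimately show ?thesis by (cases "n > 0") auto
qed

text \<open>Both sides are sums over greedy paths and are compared term by term; the 4 comes from
  \<open>weight_greedy_lower\<close>. Fixing the direction \<open>d\<close> merely selects some of
  the paths.\<close>

lemma greedy_orbit_le_greedy_run:
  assumes "reads_once loc" "d \<in> set dirs"
  shows "measure mirror_space (greedy_orbit (0,0) d (Suc n)) \<le>
    4 * measure (iid_space die) {\<omega>. \<forall>s<Suc n. fresh_nbrs (tape_hist loc \<omega> s) \<noteq> []}"
proof -
  interpret prob_space "iid_space die :: ('a \<Rightarrow> nat) measure" by (rule prob_space_iid_space)
  let ?F = "{p \<in> greedy_exts [(0,0)] (Suc n). hd p = vadd (0,0) d}"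
  have fin: "finite ?F" using finite_greedy_exts[of "[(0,0)]" "Suc n"] by (rule finite_subset[rotated]) blast
  have ev: "{\<omega>. tape_hist loc \<omega> (Suc n) = q} \<in> events" for q
    by (rule iid_event[OF measurable_tape_hist, where P = "\<lambda>r. r = q"])
  have "measure mirror_space (greedy_orbit (0,0) d (Suc n)) = (\<Sum>p\<in>?F. (1/3) ^ card (set (butlast p)))"
    by (rule prob_greedy_orbit[OF assms(2)])
  also have "\<dots> \<le> (\<Sum>p\<in>?F. 4 * weight ([(0,0)] @ p))"
    using weight_greedy_lower[of _ "(0,0)" "Suc n"] by (intro sum_mono) blast
  also have "\<dots> = 4 * (\<Sum>p\<in>?F. prob {\<omega>. tape_hist loc \<omega> (Suc n) = [(0,0)] @ p})"
    unfolding sum_distrib_left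
  proof (rule sum.cong[OF refl])
    fix p assume "p \<in> ?F"
    then have "p \<in> greedy_exts [(0,0)] (Suc n)" by blast
    from greedy_exts_length[OF this] have "length ([(0,0)] @ p) = Suc (Suc n)" by simp
    then show "4 * weight ([(0,0)] @ p) = 4 * prob {\<omega>. tape_hist loc \<omega> (Suc n) = [(0,0)] @ p}"
      using prob_tape_hist[OF assms(1), of "[(0,0)] @ p" "Suc n"] by simp
  qed
  also have "(\<Sum>p\<in>?F. prob {\<omega>. tape_hist loc \<omega> (Suc n) = [(0,0)] @ p}) =
      prob (\<Union>p\<in>?F. {\<omega>. tape_hist loc \<omega> (Suc n) = [(0,0)] @ p})"
    using fin ev by (intro finite_measure_finite_Union[symmetric]) (auto simp: disjoint_family_on_def simp del: tape_hist.simps)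
  also have "\<dots> \<le> prob {\<omega>. \<forall>s<Suc n. fresh_nbrs (tape_hist loc \<omega> s) \<noteq> []}"
  proof (rule finite_measure_mono)
    show "(\<Union>p\<in>?F. {\<omega>. tape_hist loc \<omega> (Suc n) = [(0,0)] @ p}) \<subseteq> {\<omega>. \<forall>s<Suc n. fresh_nbrs (tape_hist loc \<omega> s) \<noteq> []}"
    proof clarify
      fix \<omega> p s assume "tape_hist loc \<omega> (Suc n) = [(0,0)] @ p" "p \<in> greedy_exts [(0,0)] (Suc n)"
        "s < Suc n" "fresh_nbrs (tape_hist loc \<omega> s) = []"
      then show False using exts_imp_greedy_run[of loc \<omega> "Suc n" p s] by simp
    qed
    show "{\<omega>. \<forall>s<Suc n. fresh_nbrs (tape_hist loc \<omega> s) \<noteq> []} \<in> events"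
      using sets_greedy_run[of "Suc n" loc 0] by simp
  qed
  finally show ?thesis by simp
qed

text \<open>An endlessly greedy walk makes finitely many visits, so under recurrence the chance of
  \<open>n\<close> greedy steps tends to 0, and it dominates that of an orbit which is greedy for
  \<open>n\<close> steps.\<close>

lemma recurrent_imp_periodic_origin:
  assumes ro: "reads_once loc" and d: "d \<in> set dirs"
    and rec: "AE \<omega> in iid_space die. infinite {t. last (tape_hist loc \<omega> t) = (0,0)}"
  shows "AE c in mirror_space. periodic_orbit c (0,0) d"
proof -
  interpret prob_space "iid_space die :: ('a \<Rightarrow> nat) measure" by (rule prob_space_iid_space)
  let ?E = "\<lambda>n. {\<omega>. \<forall>s<n. fresh_nbrs (tape_hist loc \<omega> s) \<noteq> []}"
  have ev: "range ?E \<subseteq> events" using sets_greedy_run[of _ loc 0] by auto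
  have "(\<lambda>n. prob (?E n)) \<longlonglongrightarrow> prob (\<Inter>n. ?E n)"
    by (rule finite_Lim_measure_decseq[OF ev]) (force simp: decseq_def)
  moreover have "prob (\<Inter>n. ?E n) = 0"
  proof (subst prob_eq_0)
    show "(\<Inter>n. ?E n) \<in> events" using ev by auto
    show "AE \<omega> in iid_space die. \<omega> \<notin> (\<Inter>n. ?E n)"
      using rec
    proof eventually_elim
      case (elim \<omega>)
      then show ?case using finite_visits_if_greedy[of loc \<omega> "(0,0)"] by (auto simp: less_Suc_eq_le)
    qed
  qed
  ultimately have "(\<lambda>n. prob (?E n)) \<longlonglongrightarrow> 0" by simp
  then have "(\<lambda>n. prob (?E (Suc n))) \<longlonglongrightarrow> 0" by (rule LIMSEQ_Suc)
  then have L1: "(\<lambda>n. 4 * prob (?E (Suc n))) \<longlonglongrightarrow> 4 * 0" by (rule tendsto_mult_left)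
  have L2: "(\<lambda>n. measure mirror_space (greedy_orbit (0,0) d (Suc n))) \<longlonglongrightarrow> measure mirror_space {c. \<not> periodic_orbit c (0,0) d}"
    by (rule LIMSEQ_Suc[OF greedy_orbit_LIMSEQ[OF d]])
  have "measure mirror_space {c. \<not> periodic_orbit c (0,0) d} \<le> 4 * 0"
    by (rule LIMSEQ_le[OF L2 L1]) (use greedy_orbit_le_greedy_run[OF ro d] in blast)
  then show ?thesis unfolding AE_periodic_iff[OF d] by (simp add: measure_le_0_iff)
qed

section \<open>Translation invariance of the mirror model\<close>

lemma vadd_assoc: "vadd (vadd v u) d = vadd v (vadd u d)"
  by (simp add: vadd_def)

lemma funpow_mirror_step_shift:
  "(mirror_step c ^^ n) (vadd v u, d) =
    map_prod (vadd v) id ((mirror_step (\<lambda>u. c (vadd v u)) ^^ n) (u, d))"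
proof (induction n)
  case (Suc n)
  then show ?case by (simp add: mirror_step_eq map_prod_def vadd_assoc split: prod.splits)
qed simp

lemma periodic_orbit_shift: "periodic_orbit c v d \<longleftrightarrow> periodic_orbit (\<lambda>u. c (vadd v u)) (0,0) d"
proof -
  have v: "v = vadd v (0,0)" by (simp add: vadd_def)
  have "(mirror_step c ^^ n) (v, d) = (v, d) \<longleftrightarrow> (mirror_step (\<lambda>u. c (vadd v u)) ^^ n) ((0,0), d) = ((0,0), d)" for n
    using funpow_mirror_step_shift[of n c v "(0,0)" d] v
    by (cases "(mirror_step (\<lambda>u. c (vadd v u)) ^^ n) ((0,0), d)") (metis (no_types, lifting) vadd_inject map_prod_simp id_apply prod.inject)
  then show ?thesis by (simp add: periodic_orbit_def)
qed

text \<open>The maps \<open>f\<close> to which this is applied are a translation of the plane, a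
  shift of the coin sequence and the embedding \<open>Inr\<close> of the second tape.\<close>

lemma iid_space_reindex:
  assumes "inj f"
  shows "distr (iid_space p) (iid_space p) (\<lambda>\<omega> i. \<omega> (f i)) = iid_space p"
    and "(\<lambda>\<omega> i. \<omega> (f i)) \<in> measurable (iid_space p) (iid_space p)"
proof -
  show "(\<lambda>\<omega> i. \<omega> (f i)) \<in> measurable (iid_space p) (iid_space p)"
    unfolding iid_space_def by (rule measurable_PiM_single') (auto simp: space_PiM)
  show "distr (iid_space p) (iid_space p) (\<lambda>\<omega> i. \<omega> (f i)) = iid_space p"
    using distr_PiM_reindex[of UNIV "\<lambda>_. measure_pmf p" f UNIV] assms
    by (simp add: iid_space_def prob_space_measure_pmf restrict_def)
qed

lemma AE_iid_space_reindex:
  assumes "inj f" "AE \<omega> in iid_space p. P \<omega>"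
  shows "AE \<omega> in iid_space p. P (\<lambda>i. \<omega> (f i))"
proof (rule AE_distrD[OF iid_space_reindex(2)[OF assms(1)]])
  show "AE \<omega> in distr (iid_space p) (iid_space p) (\<lambda>\<omega> i. \<omega> (f i)). P \<omega>"
    unfolding iid_space_reindex(1)[OF assms(1)] by (rule assms(2))
qed

lemma AE_all_periodic:
  assumes "\<And>d. d \<in> set dirs \<Longrightarrow> AE c in mirror_space. periodic_orbit c (0,0) d"
  shows "AE c in mirror_space. \<forall>v. \<forall>d\<in>set dirs. periodic_orbit c v d"
proof -
  have "AE c in mirror_space. periodic_orbit c v d" if "d \<in> set dirs" for v d
  proof -
    have "AE c in mirror_space. periodic_orbit (\<lambda>u. c (vadd v u)) (0,0) d"
      unfolding mirror_space_eq
    proof (rule AE_iid_space_reindex[where P = "\<lambda>c. periodic_orbit c (0,0) d" and f = "vadd v"])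
      show "inj (vadd v)" by (simp add: inj_def)
      show "AE c in iid_space mirror_pmf. periodic_orbit c (0,0) d"
        using assms[OF that] by (simp only: mirror_space_eq)
    qed
    then show ?thesis by (subst periodic_orbit_shift)
  qed
  then show ?thesis by (simp add: AE_all_countable AE_ball_countable)
qed

text \<open>For each of the countably many pairs of \<open>T\<close> and \<open>h\<close>, the event
  of having history \<open>h\<close> at time \<open>T\<close> and being greedy ever after is null:
  it is bounded by a constant times the sum, over the four directions, of the chances that an orbit
  from \<open>last h\<close> is still greedy after \<open>n + 1\<close> steps. As
  \<open>last h\<close> is arbitrary, periodicity is assumed at every vertex.\<close>

lemma periodic_imp_not_greedy:
  assumes ro: "reads_once loc"
    and per: "\<And>v d. d \<in> set dirs \<Longrightarrow> AE c in mirror_space. periodic_orbit c v d"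
  shows "AE \<omega> in iid_space die. \<forall>T. \<exists>t\<ge>T. fresh_nbrs (tape_hist loc \<omega> t) = []"
proof -
  interpret prob_space "iid_space die :: ('a \<Rightarrow> nat) measure" by (rule prob_space_iid_space)
  interpret M: prob_space mirror_space by (rule prob_space_mirror)
  have "AE \<omega> in iid_space die. \<not> (tape_hist loc \<omega> T = h \<and> (\<forall>s. fresh_nbrs (tape_hist loc \<omega> (T + s)) \<noteq> []))"
    for T h
  proof (cases "length h = Suc T \<and> hd h = (0,0)")
    case False
    have "hd (tape_hist loc \<omega> T) = (0,0)" for \<omega>
      using tape_hist_reachable reachable_shape by blast
    then have "tape_hist loc \<omega> T \<noteq> h" for \<omega> using False length_tape_hist by metis
    then show ?thesis by simp
  next
    case True
    then have hn: "h \<noteq> []" by auto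
    let ?A = "{\<omega>. tape_hist loc \<omega> T = h \<and> (\<forall>s. fresh_nbrs (tape_hist loc \<omega> (T + s)) \<noteq> [])}"
    let ?x = "last h"
    have A: "?A = {\<omega>. tape_hist loc \<omega> T = h} \<inter> (\<Inter>n. {\<omega>. \<forall>s<n. fresh_nbrs (tape_hist loc \<omega> (T + s)) \<noteq> []})"
      by auto
    have Aev: "?A \<in> events"
      unfolding A
    proof (rule sets.Int)
      show "{\<omega>. tape_hist loc \<omega> T = h} \<in> events"
        by (rule iid_event[OF measurable_tape_hist, where P = "\<lambda>r. r = h"])
      show "(\<Inter>n. {\<omega>. \<forall>s<n. fresh_nbrs (tape_hist loc \<omega> (T + s)) \<noteq> []}) \<in> events"
        using sets_greedy_run by (intro sets.countable_INT) auto
    qed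
    let ?G = "\<lambda>n. \<Sum>d\<in>set dirs. measure mirror_space (greedy_orbit ?x d (Suc n))"
    have bound: "prob ?A \<le> 3 ^ card (set h) * ?G n" for n
    proof -
      let ?E = "greedy_exts h (Suc n)" and ?E' = "greedy_exts [?x] (Suc n)"
      let ?c = "\<lambda>p. (1/3::real) ^ card (set (butlast p))"
      have ev: "{\<omega>. tape_hist loc \<omega> (T + Suc n) = q} \<in> events" for q
        by (rule iid_event[OF measurable_tape_hist, where P = "\<lambda>r. r = q"])
      have "prob ?A \<le> prob (\<Union>p\<in>?E. {\<omega>. tape_hist loc \<omega> (T + Suc n) = h @ p})"
      proof (rule finite_measure_mono)
        show "?A \<subseteq> (\<Union>p\<in>?E. {\<omega>. tape_hist loc \<omega> (T + Suc n) = h @ p})"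
          using greedy_run_imp_exts[of loc _ T h "Suc n"] by blast
        show "(\<Union>p\<in>?E. {\<omega>. tape_hist loc \<omega> (T + Suc n) = h @ p}) \<in> events"
          using ev finite_greedy_exts by (intro sets.finite_UN) blast+
      qed
      also have "\<dots> \<le> (\<Sum>p\<in>?E. prob {\<omega>. tape_hist loc \<omega> (T + Suc n) = h @ p})"
        using ev finite_greedy_exts by (intro finite_measure_subadditive_finite) blast+
      also have "\<dots> = (\<Sum>p\<in>?E. weight (h @ p))"
      proof (rule sum.cong[OF refl])
        fix p assume "p \<in> ?E"
        then have "length (h @ p) = Suc (T + Suc n)" using greedy_exts_length True by simp
        moreover have "hd (h @ p) = (0,0)" using True hn by simp
        ultimately show "prob {\<omega>. tape_hist loc \<omega> (T + Suc n) = h @ p} = weight (h @ p)"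
          by (rule prob_tape_hist[OF ro])
      qed
      also have "\<dots> \<le> (\<Sum>p\<in>?E. 3 ^ card (set h) * ?c p)"
      proof (rule sum_mono)
        fix p assume p: "p \<in> ?E"
        \<comment> \<open>Vertices of \<open>h\<close> met again count in the orbit sum but not in
          the bound for the walk; there are at most \<open>card (set h)\<close> of them, each worth
          a factor 3.\<close>
        have "card (set (butlast p)) \<le> card (set (butlast p) - set h) + card (set h)"
          using card_mono[of "(set (butlast p) - set h) \<union> set h" "set (butlast p)"] card_Un_le[of "set (butlast p) - set h" "set h"]
          by (force intro: order.trans)
        then have "(1/3::real) ^ (card (set (butlast p) - set h) + card (set h)) \<le> ?c p"
          by (intro power_decreasing) auto
        then have "(1/3::real) ^ card (set (butlast p) - set h) \<le> 3 ^ card (set h) * ?c p"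
          by (simp add: power_add field_simps power_divide)
        then show "weight (h @ p) \<le> 3 ^ card (set h) * ?c p"
          using weight_greedy_upper[OF hn p] by linarith
      qed
      also have "\<dots> = 3 ^ card (set h) * (\<Sum>p\<in>?E. ?c p)" by (simp only: sum_distrib_left)
      also have "(\<Sum>p\<in>?E. ?c p) \<le> (\<Sum>p\<in>?E'. ?c p)"
        using greedy_exts_mono[OF hn, of "Suc n"] finite_greedy_exts by (intro sum_mono2) auto
      \<comment> \<open>An orbit has a fixed initial direction, so the paths are split by their
        first step.\<close>
      also have "(\<Sum>p\<in>?E'. ?c p) = (\<Sum>p\<in>(\<Union>d\<in>set dirs. {p \<in> ?E'. hd p = vadd ?x d}). ?c p)"
      proof (rule sum.cong[OF _ refl], standard)
        show "?E' \<subseteq> (\<Union>d\<in>set dirs. {p \<in> ?E'. hd p = vadd ?x d})"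
        proof
          fix p assume p: "p \<in> ?E'"
          have "hd p \<in> vadd ?x ` set dirs"
            using p by (induction n arbitrary: p) (fastforce simp: set_fresh hd_append split: if_splits)+
          then show "p \<in> (\<Union>d\<in>set dirs. {p \<in> ?E'. hd p = vadd ?x d})" using p by blast
        qed
      qed blast
      also have "\<dots> = (\<Sum>d\<in>set dirs. \<Sum>p\<in>{p \<in> ?E'. hd p = vadd ?x d}. ?c p)"
        using finite_greedy_exts[of "[?x]" "Suc n"]
        by (intro sum.UNION_disjoint) (simp_all del: greedy_exts.simps, auto simp del: greedy_exts.simps)
      also have "\<dots> = ?G n" by (intro sum.cong refl prob_greedy_orbit[symmetric])
      finally show ?thesis by (simp add: mult_left_mono)
    qed
    have "?G \<longlonglongrightarrow> (\<Sum>d\<in>set dirs. 0)"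
    proof (intro tendsto_sum)
      fix d assume d: "d \<in> set dirs"
      show "(\<lambda>n. measure mirror_space (greedy_orbit ?x d (Suc n))) \<longlonglongrightarrow> 0"
        using LIMSEQ_Suc[OF greedy_orbit_LIMSEQ[OF d, of ?x]] per[OF d, of ?x] AE_periodic_iff[OF d, of ?x] by simp
    qed
    then have L: "(\<lambda>n. 3 ^ card (set h) * ?G n) \<longlonglongrightarrow> 3 ^ card (set h) * (\<Sum>d\<in>set dirs. 0)"
      by (rule tendsto_mult_left)
    have "prob ?A \<le> 3 ^ card (set h) * (\<Sum>d\<in>set dirs. 0)"
      by (rule LIMSEQ_le_const[OF L]) (use bound in blast)
    then have "prob ?A = 0" by (simp add: measure_le_0_iff)
    then show ?thesis using prob_eq_0[OF Aev] by simp
  qed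
  then have "AE \<omega> in iid_space die. \<forall>T h. \<not> (tape_hist loc \<omega> T = h \<and> (\<forall>s. fresh_nbrs (tape_hist loc \<omega> (T + s)) \<noteq> []))"
    unfolding AE_all_countable by blast
  then show ?thesis
  proof eventually_elim
    case (elim \<omega>)
    show ?case
    proof
      fix T
      obtain s where "fresh_nbrs (tape_hist loc \<omega> (T + s)) = []" using elim by blast
      then show "\<exists>t\<ge>T. fresh_nbrs (tape_hist loc \<omega> t) = []" by (intro exI[of _ "T + s"]) simp
    qed
  qed
qed

section \<open>Recurrence of the simple random walk\<close>

abbreviation die_seq :: "(nat \<Rightarrow> nat) measure" where
  "die_seq \<equiv> iid_space die"

text \<open>\<open>comb_seq n\<close> puts the first \<open>n\<close> terms of one sequence before
  an independent second sequence. The result has the same law, and under it the event becomes the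
  rectangle \<open>A \<times> B\<close>.\<close>

lemma prob_past_future:
  assumes A: "A \<in> sets die_seq" and B: "B \<in> sets die_seq"
    and past: "\<And>\<omega> \<omega>'. (\<And>j. j < n \<Longrightarrow> \<omega> j = \<omega>' j) \<Longrightarrow> \<omega> \<in> A \<longleftrightarrow> \<omega>' \<in> A"
  shows "measure die_seq (A \<inter> {\<omega>. (\<lambda>k. \<omega> (k + n)) \<in> B}) = measure die_seq A * measure die_seq B"
proof -
  interpret sequence_space "measure_pmf die" by standard
  have S: "S = die_seq" by (simp add: iid_space_def)
  interpret D: prob_space die_seq by (rule prob_space_iid_space)
  have mc: "(\<lambda>(\<omega>, \<omega>'). comb_seq n \<omega> \<omega>') \<in> measurable (die_seq \<Otimes>\<^sub>M die_seq) die_seq"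
    unfolding S[symmetric] by measurable
  have "(\<lambda>\<omega> k. \<omega> (k + n)) \<in> measurable die_seq die_seq"
    by (rule iid_space_reindex(2)) (simp add: inj_def)
  from measurable_sets[OF this B] have "{\<omega>. (\<lambda>k. \<omega> (k + n)) \<in> B} \<in> sets die_seq"
    by (simp add: vimage_def)
  then have E: "A \<inter> {\<omega>. (\<lambda>k. \<omega> (k + n)) \<in> B} \<in> sets die_seq" using A by blast
  have "measure die_seq (A \<inter> {\<omega>. (\<lambda>k. \<omega> (k + n)) \<in> B}) =
      measure (distr (die_seq \<Otimes>\<^sub>M die_seq) die_seq (\<lambda>(\<omega>, \<omega>'). comb_seq n \<omega> \<omega>')) (A \<inter> {\<omega>. (\<lambda>k. \<omega> (k + n)) \<in> B})"
    using PiM_comb_seq[of n] by (simp add: S)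
  also have "\<dots> = measure (die_seq \<Otimes>\<^sub>M die_seq)
      ((\<lambda>(\<omega>, \<omega>'). comb_seq n \<omega> \<omega>') -` (A \<inter> {\<omega>. (\<lambda>k. \<omega> (k + n)) \<in> B}) \<inter> space (die_seq \<Otimes>\<^sub>M die_seq))"
    by (rule measure_distr[OF mc E])
  also have "(\<lambda>(\<omega>, \<omega>'). comb_seq n \<omega> \<omega>') -` (A \<inter> {\<omega>. (\<lambda>k. \<omega> (k + n)) \<in> B}) \<inter> space (die_seq \<Otimes>\<^sub>M die_seq) = A \<times> B"
  proof -
    have "comb_seq n \<omega> \<omega>' \<in> A \<longleftrightarrow> \<omega> \<in> A" for \<omega> \<omega>'
      by (rule past) (simp add: comb_seq_less)
    moreover have "(\<lambda>k. comb_seq n \<omega> \<omega>' (k + n)) = \<omega>'" for \<omega> \<omega>' :: "nat \<Rightarrow> nat" by (simp add: comb_seq_add)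
    ultimately show ?thesis by (auto simp: space_pair_measure)
  qed
  also have "measure (die_seq \<Otimes>\<^sub>M die_seq) (A \<times> B) = measure die_seq A * measure die_seq B"
    using D.emeasure_pair_measure_Times[OF A B] by (simp add: measure_def enn2real_mult)
  finally show ?thesis .
qed

section \<open>Return probabilities of the simple random walk\<close>

lemma srw_cong: "(\<And>j. j < n \<Longrightarrow> \<omega> j = \<omega>' j) \<Longrightarrow> srw \<omega> n = srw \<omega>' n"
  by (induction n) simp_all

lemma srw_add: "srw \<omega> (k + n) = vadd (srw \<omega> n) (srw (\<lambda>k. \<omega> (k + n)) k)"
proof (induction k)
  case 0
  show ?case by (simp add: vadd_def)
next
  case (Suc k)
  then show ?case by (simp add: vadd_assoc)
qed

lemma measurable_srw: "(\<lambda>\<omega>. srw \<omega> n) \<in> measurable die_seq (count_space UNIV)"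
proof (induction n)
  case 0
  show ?case unfolding srw.simps by (rule measurable_const) simp
next
  case (Suc n)
  have "(\<lambda>\<omega>. vadd x (dirs ! (\<omega> n mod 4))) \<in> measurable die_seq (count_space UNIV)" for x
    by (rule measurable_compose[OF measurable_iid_coord[of n]]) simp
  from measurable_compose_countable[OF this Suc] show ?case unfolding srw.simps .
qed

lemma sets_srw: "{\<omega>. srw \<omega> n = x} \<in> sets die_seq"
  by (rule iid_event[OF measurable_srw, where P = "\<lambda>y. y = x"])

lemma prob_srw_Suc:
  "measure die_seq {\<omega>. srw \<omega> (Suc n) = x} =
    (\<Sum>i<4. measure die_seq {\<omega>. srw \<omega> n = vadd x (vneg (dirs ! i))}) / 4"
proof -
  interpret prob_space die_seq by (rule prob_space_iid_space)
  let ?A = "\<lambda>i. {\<omega>. srw \<omega> n = vadd x (vneg (dirs ! i))}"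
  let ?B = "\<lambda>i. {\<omega>::nat \<Rightarrow> nat. \<omega> 0 mod 4 = i}"
  let ?E = "\<lambda>i. ?A i \<inter> {\<omega>. (\<lambda>k. \<omega> (k + n)) \<in> ?B i}"
  have B: "?B i \<in> sets die_seq" for i
    by (rule iid_event[OF measurable_iid_coord, where P = "\<lambda>u. u mod 4 = i"])
  have pB: "prob (?B i) = 1 / 4" if "i < 4" for i
  proof -
    have "prob (?B i) = prob {\<omega>. \<forall>j\<in>{0}. \<omega> j \<in> {u. u mod 4 = i}}" by simp
    also have "\<dots> = (\<Prod>j\<in>{0::nat}. measure (measure_pmf die) {u. u mod 4 = i})"
      by (rule measure_iid_cylinder) simp
    also have "\<dots> = 1 / 4" using prob_die_mod[of 4 i] that by simp
    finally show ?thesis .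
  qed
  have step: "vadd y d = x \<longleftrightarrow> y = vadd x (vneg d)" for y d
    by (auto simp: vadd_def vneg_def prod_eq_iff)
  have "{\<omega>. srw \<omega> (Suc n) = x} = (\<Union>i\<in>{..<4}. ?E i)"
    by (auto simp: step)
  also have "prob \<dots> = (\<Sum>i<4. prob (?E i))"
  proof (rule finite_measure_finite_Union)
    have "{\<omega>. \<omega> n mod 4 = i} \<in> sets die_seq" for i
      by (rule iid_event[OF measurable_iid_coord, where P = "\<lambda>u. u mod 4 = i"])
    then show "?E ` {..<4} \<subseteq> events"
      by (intro image_subsetI sets.Int sets_srw) simp
  qed (auto simp: disjoint_family_on_def)
  also have "\<dots> = (\<Sum>i<4. prob (?A i) / 4)"
  proof (rule sum.cong[OF refl])
    fix i :: nat assume "i \<in> {..<4}"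
    have "prob (?E i) = prob (?A i) * prob (?B i)"
    proof (rule prob_past_future[OF sets_srw B])
      fix \<omega> \<omega>' :: "nat \<Rightarrow> nat" assume "\<And>j. j < n \<Longrightarrow> \<omega> j = \<omega>' j"
      then have "srw \<omega> n = srw \<omega>' n" by (rule srw_cong)
      then show "\<omega> \<in> ?A i \<longleftrightarrow> \<omega>' \<in> ?A i" by simp
    qed
    then show "prob (?E i) = prob (?A i) / 4" using pB \<open>i \<in> {..<4}\<close> by simp
  qed
  finally show ?thesis by (simp add: sum_divide_distrib)
qed

text \<open>In the coordinates x + y and x - y the planar walk
  is a pair of independent one-dimensional ones.\<close>
fun walk1 :: "nat \<Rightarrow> int \<Rightarrow> real" where
  "walk1 0 k = (if k = 0 then 1 else 0)"
| "walk1 (Suc n) k = (walk1 n (k - 1) + walk1 n (k + 1)) / 2"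

text \<open>The four unit steps change x + y and x - y by the four pairs of signs, each pair once,
  so the product of two one-dimensional solutions satisfies the planar recursion.\<close>

lemma prob_srw: "measure die_seq {\<omega>. srw \<omega> n = (x, y)} = walk1 n (x + y) * walk1 n (x - y)"
proof (induction n arbitrary: x y)
  case 0
  interpret prob_space die_seq by (rule prob_space_iid_space)
  show ?case using prob_space by (cases "x = 0 \<and> y = 0") auto
next
  case (Suc n)
  have "{..<4::nat} = {0, 1, 2, 3}" by auto
  then show ?case unfolding prob_srw_Suc
    by (simp add: dirs_def vadd_def vneg_def Suc) (simp add: field_simps)
qed

lemma walk1_zero: "k < - int n \<Longrightarrow> walk1 n k = 0"
  by (induction n arbitrary: k) simp_all

text \<open>With \<open>j\<close> of the \<open>n\<close> steps upward the walk is at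
  \<open>2 * int j - int n\<close>; its recursion is then Pascal's rule.\<close>

lemma walk1_binomial: "walk1 n (2 * int j - int n) = real (n choose j) / 2 ^ n"
proof (induction n arbitrary: j)
  case 0
  then show ?case by (cases j) auto
next
  case (Suc n)
  show ?case
  proof (cases j)
    case 0
    have e: "2 * int 0 - int (Suc n) + 1 = 2 * int 0 - int n" by simp
    show ?thesis unfolding 0 walk1.simps e Suc[of 0] by (simp add: walk1_zero)
  next
    case (Suc i)
    have e: "2 * int (Suc i) - int (Suc n) - 1 = 2 * int i - int n"
      "2 * int (Suc i) - int (Suc n) + 1 = 2 * int (Suc i) - int n" by simp_all
    show ?thesis unfolding Suc walk1.simps e Suc.IH by (simp add: field_simps)
  qed
qed

section \<open>A lower bound for central binomial coefficients\<close>

lemma central_binomial_Suc: "Suc n * (2 * Suc n choose Suc n) = 2 * (2 * n + 1) * (2 * n choose n)"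
proof -
  have 1: "Suc n * (2 * Suc n choose Suc n) = (2 * n + 2) * (Suc (2 * n) choose n)"
    using Suc_times_binomial[of n "Suc (2 * n)"] by simp
  have 2: "Suc n * (Suc (2 * n) choose Suc n) = Suc (2 * n) * (2 * n choose n)"
    using Suc_times_binomial[of n "2 * n"] by simp
  have "Suc (2 * n) choose n = Suc (2 * n) choose Suc n"
    using binomial_symmetric[of n "Suc (2 * n)"] by simp
  then have "Suc n * (2 * Suc n choose Suc n) = 2 * (Suc n * (Suc (2 * n) choose Suc n))"
    using 1 by simp
  then show ?thesis unfolding 2 by simp
qed

text \<open>From n to n + 1 the quantity inside the square is multiplied by (2n + 1) / (2n + 2),
  whose square is at least n / (n + 1) because 4n(n + 1) \<le> (2n + 1)^2. So n times the right-hand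
  side is nondecreasing, and 1/4 is its value at n = 1.\<close>

lemma central_binomial_sq_ge:
  assumes "n > 0"
  shows "1 / (4 * real n) \<le> (real (2 * n choose n) / 4 ^ n)\<^sup>2"
  using assms
proof (induction n rule: nat_induct_non_zero)
  case 1
  then show ?case by (simp add: power2_eq_square)
next
  case (Suc n)
  define C where "C = real (2 * n choose n)"
  define C' where "C' = real (2 * Suc n choose Suc n)"
  define a where "a = C / 4 ^ n"
  define b where "b = C' / 4 ^ Suc n"
  have "real (Suc n * (2 * Suc n choose Suc n)) = real (2 * (2 * n + 1) * (2 * n choose n))"
    by (simp only: central_binomial_Suc)
  then have "real (Suc n) * C' = 2 * (2 * real n + 1) * C"
    unfolding C_def C'_def by (simp only: of_nat_mult) simp
  then have cc: "C' = 2 * (2 * real n + 1) * C / (real n + 1)"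
    by (simp add: field_simps)
  have ab: "b = (2 * real n + 1) / (2 * (real n + 1)) * a"
  proof -
    have "2 * x * C / y / (4 * z) = x / (2 * y) * (C / z)" for x y z :: real by (simp add: mult.commute mult.left_commute)
    then show ?thesis unfolding a_def b_def cc power_Suc .
  qed
  have n: "real n > 0" using Suc by simp
  have "1 / (4 * y) \<le> (z / (2 * y))\<^sup>2 * (1 / (4 * x))" if "x > 0" "y > 0" "4 * x * y \<le> z\<^sup>2" for x y z :: real
  proof -
    have "1 / (4 * y) = 4 * x * y / (16 * x * y\<^sup>2)" using that by (simp add: power2_eq_square)
    also have "\<dots> \<le> z\<^sup>2 / (16 * x * y\<^sup>2)" using that by (intro divide_right_mono) auto
    also have "\<dots> = (z / (2 * y))\<^sup>2 * (1 / (4 * x))" by (simp add: power2_eq_square mult.commute mult.left_commute)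
    finally show ?thesis .
  qed
  from this[of "real n" "real n + 1" "2 * real n + 1"]
  have "1 / (4 * (real n + 1)) \<le> ((2 * real n + 1) / (2 * (real n + 1)))\<^sup>2 * (1 / (4 * real n))"
    using n by (simp add: power2_eq_square algebra_simps)
  also have "\<dots> \<le> ((2 * real n + 1) / (2 * (real n + 1)))\<^sup>2 * a\<^sup>2"
    using Suc.IH by (intro mult_left_mono) (simp_all add: a_def C_def)
  also have "\<dots> = b\<^sup>2" unfolding ab by (simp only: power_mult_distrib)
  finally show ?case unfolding b_def C'_def by (simp only: of_nat_Suc add.commute)
qed

lemma prob_srw_return_ge:
  assumes "n > 0"
  shows "measure die_seq {\<omega>. srw \<omega> (2 * n) = (0,0)} \<ge> 1 / (4 * real n)"
proof -
  have "walk1 (2 * n) 0 = real (2 * n choose n) / 4 ^ n"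
    using walk1_binomial[of "2 * n" n] by (simp add: power_mult)
  then have "measure die_seq {\<omega>. srw \<omega> (2 * n) = (0,0)} = (real (2 * n choose n) / 4 ^ n)\<^sup>2"
    unfolding prob_srw by (simp add: power2_eq_square)
  then show ?thesis using central_binomial_sq_ge[OF assms] by simp
qed

text \<open>The events that time n is the last visit to the origin are disjoint, and each has probability
  P(visit at n) * P(no return); as the visit probabilities are not summable, P(no return) = 0.\<close>
theorem srw_recurrent: "AE \<omega> in die_seq. infinite {n. srw \<omega> n = (0,0)}"
proof -
  interpret prob_space die_seq by (rule prob_space_iid_space)
  define Q where "Q = {\<omega>. \<forall>k>0. srw \<omega> k \<noteq> (0,0)}"
  define L where "L n = {\<omega>. srw \<omega> n = (0,0)} \<inter> {\<omega>. (\<lambda>k. \<omega> (k + n)) \<in> Q}" for n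
  have "Q = space die_seq - (\<Union>k\<in>{0<..}. {\<omega>. srw \<omega> k = (0,0)})" by (auto simp: Q_def)
  moreover have "(\<Union>k\<in>{0<..}. {\<omega>. srw \<omega> k = (0,0)}) \<in> events"
    using sets_srw by (intro sets.countable_UN') auto
  ultimately have Q: "Q \<in> events" by (simp only: sets.Diff sets.top)
  have pL: "prob (L n) = prob {\<omega>. srw \<omega> n = (0,0)} * prob Q" for n
    unfolding L_def
  proof (rule prob_past_future[OF sets_srw Q])
    fix \<omega> \<omega>' :: "nat \<Rightarrow> nat" assume "\<And>j. j < n \<Longrightarrow> \<omega> j = \<omega>' j"
    then have "srw \<omega> n = srw \<omega>' n" by (rule srw_cong)
    then show "\<omega> \<in> {\<omega>. srw \<omega> n = (0,0)} \<longleftrightarrow> \<omega>' \<in> {\<omega>. srw \<omega> n = (0,0)}" by simp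
  qed
  have "(\<lambda>\<omega> k. \<omega> (k + n)) \<in> measurable die_seq die_seq" for n
    by (rule iid_space_reindex(2)) (simp add: inj_def)
  from measurable_sets[OF this Q] have L: "L n \<in> events" for n
    unfolding L_def using sets_srw by (auto simp: vimage_def)
  have L_eq: "L n = {\<omega>. srw \<omega> n = (0,0) \<and> (\<forall>m>n. srw \<omega> m \<noteq> (0,0))}" for n
  proof -
    have "(\<forall>k>0. srw (\<lambda>k. \<omega> (k + n)) k \<noteq> (0,0)) \<longleftrightarrow> (\<forall>m>n. srw \<omega> m \<noteq> (0,0))"
      if "srw \<omega> n = (0,0)" for \<omega>
    proof -
      have "srw \<omega> (k + n) = srw (\<lambda>k. \<omega> (k + n)) k" for k
        using srw_add[of \<omega> k n] that by (simp add: vadd_def)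
      then have "(\<forall>k>0. srw (\<lambda>k. \<omega> (k + n)) k \<noteq> (0,0)) \<longleftrightarrow> (\<forall>k>0. srw \<omega> (k + n) \<noteq> (0,0))" by simp
      also have "\<dots> \<longleftrightarrow> (\<forall>m>n. srw \<omega> m \<noteq> (0,0))"
      proof (intro iffI allI impI)
        fix m assume *: "\<forall>k>0. srw \<omega> (k + n) \<noteq> (0,0)" "n < m"
        then show "srw \<omega> m \<noteq> (0,0)" using *(1)[rule_format, of "m - n"] by simp
      qed simp
      finally show ?thesis .
    qed
    then show ?thesis by (auto simp: L_def Q_def)
  qed
  have disj: "L n \<inter> L n' = {}" if "n < n'" for n n'
    using that unfolding L_eq by blast
  \<comment> \<open>Only positive even times are used, since \<open>prob_srw_return_ge\<close>
    bounds exactly those.\<close>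
  have "disjoint_family (\<lambda>m. L (2 * Suc m))"
    unfolding disjoint_family_on_def
  proof (intro ballI impI)
    fix m m' :: nat assume "m \<noteq> m'"
    then consider "2 * Suc m < 2 * Suc m'" | "2 * Suc m' < 2 * Suc m" by (cases m m' rule: linorder_cases) auto
    then show "L (2 * Suc m) \<inter> L (2 * Suc m') = {}"
      using disj by cases blast+
  qed
  then have "(\<lambda>m. prob (L (2 * Suc m))) sums prob (\<Union>m. L (2 * Suc m))"
    using L by (intro finite_measure_UNION) auto
  then have sm: "summable (\<lambda>m. prob (L (2 * Suc m)))" by (rule sums_summable)
  have "summable (\<lambda>m. prob Q / 4 * inverse (real (Suc m)))"
  proof (rule summable_comparison_test'[OF sm])
    fix m :: nat
    have "1 / (4 * real (Suc m)) * prob Q \<le> prob (L (2 * Suc m))"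
      unfolding pL by (rule mult_right_mono[OF prob_srw_return_ge]) simp_all
    then show "norm (prob Q / 4 * inverse (real (Suc m))) \<le> prob (L (2 * Suc m))"
      by (simp add: field_simps)
  qed
  then have "prob Q / 4 = 0 \<or> summable (\<lambda>m. inverse (real (Suc m)))"
    by (simp only: summable_cmult_iff)
  moreover have "\<not> summable (\<lambda>m. inverse (real (Suc m)))"
    using not_summable_harmonic[where 'a = real] summable_Suc_iff[of "\<lambda>m. inverse (real m)"] by simp
  ultimately have "prob (L n) = 0" for n using pL by simp
  then have "AE \<omega> in die_seq. \<omega> \<notin> L n" for n using prob_eq_0[OF L] by blast
  then have "AE \<omega> in die_seq. \<forall>n. \<omega> \<notin> L n" by (simp add: AE_all_countable)
  then show ?thesis
  proof eventually_elim
    case (elim \<omega>)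
    show ?case
    proof
      assume fin: "finite {n. srw \<omega> n = (0,0)}"
      \<comment> \<open>The walk starts at the origin, so a finite set of visits is nonempty and has
        a last element.\<close>
      have "0 \<in> {n. srw \<omega> n = (0,0)}" by simp
      then have "Max {n. srw \<omega> n = (0,0)} \<in> {n. srw \<omega> n = (0,0)}" using Max_in[OF fin] by blast
      moreover have "\<forall>m>Max {n. srw \<omega> n = (0,0)}. srw \<omega> m \<noteq> (0,0)"
        using Max_ge[OF fin] by (meson leD mem_Collect_eq)
      ultimately show False using elim unfolding L_eq by blast
    qed
  qed
qed

theorem mainTheorem15:
  shows "(AE \<omega> in grw_space. infinite {t. grw_pos \<omega> t = (0,0)})
     \<longleftrightarrow> (AE c in mirror_space. \<forall>v. \<forall>d\<in>set dirs. periodic_orbit c v d)"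
proof -
  let ?len = "\<lambda>h. length h - 1"
  have "(AE \<omega> in die_seq. infinite {t. last (tape_hist ?len \<omega> t) = (0,0)})
     \<longleftrightarrow> (AE c in mirror_space. \<forall>v. \<forall>d\<in>set dirs. periodic_orbit c v d)"
  proof
    assume "AE \<omega> in die_seq. infinite {t. last (tape_hist ?len \<omega> t) = (0,0)}"
    then show "AE c in mirror_space. \<forall>v. \<forall>d\<in>set dirs. periodic_orbit c v d"
      using recurrent_imp_periodic_origin[OF reads_once_length] by (intro AE_all_periodic)
  next
    assume per: "AE c in mirror_space. \<forall>v. \<forall>d\<in>set dirs. periodic_orbit c v d"
    have "AE c in mirror_space. periodic_orbit c v d" if "d \<in> set dirs" for v d
      using per by eventually_elim (use that in blast)
    then have "AE \<omega> in iid_space die. \<forall>T. \<exists>t\<ge>T. fresh_nbrs (tape_hist two_tape_loc \<omega> t) = []"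
      by (rule periodic_imp_not_greedy[OF reads_once_two_tape])
    \<comment> \<open>The cells \<open>Inr k\<close> alone form an i.i.d. sequence of coins, so
      recurrence of \<open>srw\<close> applies to them.\<close>
    moreover have "AE \<omega> in iid_space die. infinite {k. srw (\<lambda>k. \<omega> (Inr k :: nat + nat)) k = (0,0)}"
      by (rule AE_iid_space_reindex[OF _ srw_recurrent]) simp
    ultimately have "AE \<omega> in iid_space die. infinite {t. last (tape_hist two_tape_loc \<omega> t) = (0,0)}"
      by eventually_elim (rule two_tape_recurrent, blast+)
    then show "AE \<omega> in die_seq. infinite {t. last (tape_hist ?len \<omega> t) = (0,0)}"
      by (rule AE_infinite_visits_transfer[OF reads_once_two_tape reads_once_length])
  qed
  then show ?thesis unfolding grw_space_eq grw_pos_def grw_hist_eq_tape_hist .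
qed

end
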